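(* Let $\mathcal D$ be a triangulated category with a bounded $t$-structure $(\mathcal D^{\leq 0},\mathcal D^{\geq 0})$ and let $d\geq 1$. There is a bijection between semibricks in $\mathcal D^{[-d+1,0]}$ and finite-length wide subcategories in $\mathcal D^{[-d+1,0]}$.
   Context: All subcategories are full, closed under isomorphisms and contain the zero object. $\mathcal D^{\leq n}=\mathcal D^{\leq 0}[-n]$, $\mathcal D^{\geq m}=\mathcal D^{\geq 0}[-m]$, $\mathcal D^{[m,n]}=\mathcal D^{\leq n}\cap\mathcal D^{\geq m}$. A semibrick in $\mathcal D^{[-d+1,0]}$ is a collection $\mathcal S$ of objects of $\mathcal D^{[-d+1,0]}$, considered up to isomorphism, such that (1) $\operatorname{End}(S)$ is a division ring for all $S\in\mathcal S$; (2) $\operatorname{Hom}(\mathcal S,\mathcal S[i])=0$ for all $i<0$; (3) $\operatorname{Hom}(S,S')=0$ for all $S\neq S'$ in $\mathcal S$. A subcategory $\mathcal W\subseteq\mathcal D^{[-d+1,0]}$ is wide if (1) $\mathcal W$ is closed under extensions (if $A\to Z\to B\to A[1]$ is a triangle with $A,B\in\mathcal W$ then $Z\in\mathcal W$); (2) $\operatorname{Hom}(\mathcal W,\mathcal W[i])=0$ for all $i<0$; (3) the extriangulated structure of $\mathcal D^{[-d+1,0]}$ restricted to $\mathcal W$ is abelian, i.e. $\mathcal W$ is an abelian category such that, for $X,Y,Z\in\mathcal W$, $0\to X\to Y\to Z\to 0$ is a short exact sequence if and only if $X\to Y\to Z$ completes to a triangle $X\to Y\to Z\to X[1]$ in $\mathcal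 D$. It is finite-length if every object of the abelian category $\mathcal W$ has finite length. *)

theory Defs
  imports Main "HOL-Algebra.Ring"
begin

section \<open>Categories and isomorphisms\<close>

text \<open>
  Composition is untyped and is constrained only on composable morphisms between objects. The
  sets \<open>Hom C X Y\<close> are not required to be disjoint; the usual disjointness convention is a special
  case.
\<close>

record ('o, 'm) category =
  Obj :: "'o set"
  Hom :: "'o \<Rightarrow> 'o \<Rightarrow> 'm set"
  Comp :: "'m \<Rightarrow> 'm \<Rightarrow> 'm" (infixl "\<cdot>\<index>" 70)
  Ident :: "'o \<Rightarrow> 'm"

locale category =
  fixes C :: "('o, 'm, 'x) category_scheme" (structure)
  assumes Ident_in_Hom: "X \<in> Obj C \<Longrightarrow> Ident C X \<in> Hom C X X"
    and Comp_in_Hom: "\<lbrakk>X \<in> Obj C; Y \<in> Obj C; Z \<in> Obj C; f \<in> Hom C X Y; g \<in> Hom C Y Z\<rbrakk>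
      \<Longrightarrow> g \<cdot> f \<in> Hom C X Z"
    and Comp_assoc: "\<lbrakk>W \<in> Obj C; X \<in> Obj C; Y \<in> Obj C; Z \<in> Obj C;
      f \<in> Hom C W X; g \<in> Hom C X Y; h \<in> Hom C Y Z\<rbrakk> \<Longrightarrow> h \<cdot> g \<cdot> f = h \<cdot> (g \<cdot> f)"
    and Comp_Ident_left: "\<lbrakk>X \<in> Obj C; Y \<in> Obj C; f \<in> Hom C X Y\<rbrakk> \<Longrightarrow> Ident C Y \<cdot> f = f"
    and Comp_Ident_right: "\<lbrakk>X \<in> Obj C; Y \<in> Obj C; f \<in> Hom C X Y\<rbrakk> \<Longrightarrow> f \<cdot> Ident C X = f"

definition is_iso :: "('o, 'm, 'x) category_scheme \<Rightarrow> 'o \<Rightarrow> 'o \<Rightarrow> 'm \<Rightarrow> bool" where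
  "is_iso C X Y f \<longleftrightarrow> f \<in> Hom C X Y \<and>
     (\<exists>g \<in> Hom C Y X. g \<cdot>\<^bsub>C\<^esub> f = Ident C X \<and> f \<cdot>\<^bsub>C\<^esub> g = Ident C Y)"

definition isomorphic :: "('o, 'm, 'x) category_scheme \<Rightarrow> 'o \<Rightarrow> 'o \<Rightarrow> bool" where
  "isomorphic C X Y \<longleftrightarrow> (\<exists>f. is_iso C X Y f)"

definition is_mono :: "('o, 'm, 'x) category_scheme \<Rightarrow> 'o \<Rightarrow> 'o \<Rightarrow> 'm \<Rightarrow> bool" where
  "is_mono C X Y f \<longleftrightarrow> f \<in> Hom C X Y \<and>
     (\<forall>W \<in> Obj C. \<forall>u \<in> Hom C W X. \<forall>v \<in> Hom C W X. f \<cdot>\<^bsub>C\<^esub> u = f \<cdot>\<^bsub>C\<^esub> v \<longrightarrow> u = v)"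

definition is_epi :: "('o, 'm, 'x) category_scheme \<Rightarrow> 'o \<Rightarrow> 'o \<Rightarrow> 'm \<Rightarrow> bool" where
  "is_epi C X Y f \<longleftrightarrow> f \<in> Hom C X Y \<and>
     (\<forall>Z \<in> Obj C. \<forall>u \<in> Hom C Y Z. \<forall>v \<in> Hom C Y Z. u \<cdot>\<^bsub>C\<^esub> f = v \<cdot>\<^bsub>C\<^esub> f \<longrightarrow> u = v)"

definition zero_object :: "('o, 'm, 'x) category_scheme \<Rightarrow> 'o \<Rightarrow> bool" where
  "zero_object C N \<longleftrightarrow> N \<in> Obj C \<and>
     (\<forall>X \<in> Obj C. (\<exists>!f. f \<in> Hom C X N) \<and> (\<exists>!f. f \<in> Hom C N X))"

text \<open>
  Since the morphisms between objects of a full subcategory are unchanged, only the object set is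
  replaced.
\<close>

definition full_subcategory ::
  "('o, 'm, 'x) category_scheme \<Rightarrow> 'o set \<Rightarrow> ('o, 'm, 'x) category_scheme" where
  "full_subcategory C W = C\<lparr>Obj := W\<rparr>"

text \<open>Full subcategories are identified with their object sets.\<close>

definition strict_subcategory :: "('o, 'm, 'x) category_scheme \<Rightarrow> 'o set \<Rightarrow> bool" where
  "strict_subcategory C W \<longleftrightarrow> W \<subseteq> Obj C \<and>
     (\<forall>X \<in> W. \<forall>Y \<in> Obj C. isomorphic C X Y \<longrightarrow> Y \<in> W) \<and>
     (\<exists>N \<in> W. zero_object C N)"


section \<open>Additive and abelian categories\<close>

record ('o, 'm) preadditive_category = "('o, 'm) category" +
  AddHom :: "'m \<Rightarrow> 'm \<Rightarrow> 'm" (infixl "\<boxplus>\<index>" 65)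
  ZeroHom :: "'o \<Rightarrow> 'o \<Rightarrow> 'm"

definition hom_group ::
  "('o, 'm, 'x) preadditive_category_scheme \<Rightarrow> 'o \<Rightarrow> 'o \<Rightarrow> 'm monoid" where
  "hom_group C X Y = \<lparr>carrier = Hom C X Y, monoid.mult = AddHom C, one = ZeroHom C X Y\<rparr>"

definition neg_hom ::
  "('o, 'm, 'x) preadditive_category_scheme \<Rightarrow> 'o \<Rightarrow> 'o \<Rightarrow> 'm \<Rightarrow> 'm" where
  "neg_hom C X Y f = inv\<^bsub>hom_group C X Y\<^esub> f"

locale preadditive_category = category C
  for C :: "('o, 'm, 'x) preadditive_category_scheme" (structure) +
  assumes comm_group_hom_group: "\<lbrakk>X \<in> Obj C; Y \<in> Obj C\<rbrakk> \<Longrightarrow> comm_group (hom_group C X Y)"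
    and Comp_add_left: "\<lbrakk>X \<in> Obj C; Y \<in> Obj C; Z \<in> Obj C;
      f \<in> Hom C X Y; g \<in> Hom C Y Z; h \<in> Hom C Y Z\<rbrakk>
      \<Longrightarrow> (g \<boxplus> h) \<cdot> f = (g \<cdot> f) \<boxplus> (h \<cdot> f)"
    and Comp_add_right: "\<lbrakk>X \<in> Obj C; Y \<in> Obj C; Z \<in> Obj C;
      f \<in> Hom C X Y; g \<in> Hom C X Y; h \<in> Hom C Y Z\<rbrakk>
      \<Longrightarrow> h \<cdot> (f \<boxplus> g) = (h \<cdot> f) \<boxplus> (h \<cdot> g)"

definition is_biproduct ::
  "('o, 'm, 'x) preadditive_category_scheme \<Rightarrow> 'o \<Rightarrow> 'o \<Rightarrow> 'o \<Rightarrow> 'm \<Rightarrow> 'm \<Rightarrow> 'm \<Rightarrow> 'm \<Rightarrow> bool" where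
  "is_biproduct C X Y B i j p q \<longleftrightarrow>
     B \<in> Obj C \<and> i \<in> Hom C X B \<and> j \<in> Hom C Y B \<and> p \<in> Hom C B X \<and> q \<in> Hom C B Y \<and>
     p \<cdot>\<^bsub>C\<^esub> i = Ident C X \<and> q \<cdot>\<^bsub>C\<^esub> j = Ident C Y \<and>
     q \<cdot>\<^bsub>C\<^esub> i = ZeroHom C X Y \<and> p \<cdot>\<^bsub>C\<^esub> j = ZeroHom C Y X \<and>
     (i \<cdot>\<^bsub>C\<^esub> p) \<boxplus>\<^bsub>C\<^esub> (j \<cdot>\<^bsub>C\<^esub> q) = Ident C B"

locale additive_category = preadditive_category C
  for C :: "('o, 'm, 'x) preadditive_category_scheme" (structure) +
  assumes ex_zero_object: "\<exists>N. zero_object C N"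
    and ex_biproduct: "\<lbrakk>X \<in> Obj C; Y \<in> Obj C\<rbrakk> \<Longrightarrow> \<exists>B i j p q. is_biproduct C X Y B i j p q"

definition is_kernel ::
  "('o, 'm, 'x) preadditive_category_scheme \<Rightarrow> 'o \<Rightarrow> 'o \<Rightarrow> 'm \<Rightarrow> 'o \<Rightarrow> 'm \<Rightarrow> bool" where
  "is_kernel C X Y f K k \<longleftrightarrow>
     K \<in> Obj C \<and> k \<in> Hom C K X \<and> f \<cdot>\<^bsub>C\<^esub> k = ZeroHom C K Y \<and>
     (\<forall>W \<in> Obj C. \<forall>u \<in> Hom C W X. f \<cdot>\<^bsub>C\<^esub> u = ZeroHom C W Y \<longrightarrow>
        (\<exists>!v. v \<in> Hom C W K \<and> k \<cdot>\<^bsub>C\<^esub> v = u))"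

definition is_cokernel ::
  "('o, 'm, 'x) preadditive_category_scheme \<Rightarrow> 'o \<Rightarrow> 'o \<Rightarrow> 'm \<Rightarrow> 'o \<Rightarrow> 'm \<Rightarrow> bool" where
  "is_cokernel C X Y f Q q \<longleftrightarrow>
     Q \<in> Obj C \<and> q \<in> Hom C Y Q \<and> q \<cdot>\<^bsub>C\<^esub> f = ZeroHom C X Q \<and>
     (\<forall>Z \<in> Obj C. \<forall>u \<in> Hom C Y Z. u \<cdot>\<^bsub>C\<^esub> f = ZeroHom C X Z \<longrightarrow>
        (\<exists>!v. v \<in> Hom C Q Z \<and> v \<cdot>\<^bsub>C\<^esub> q = u))"

locale abelian_category = additive_category C
  for C :: "('o, 'm, 'x) preadditive_category_scheme" (structure) +
  assumes ex_kernel: "\<lbrakk>X \<in> Obj C; Y \<in> Obj C; f \<in> Hom C X Y\<rbrakk> \<Longrightarrow> \<exists>K k. is_kernel C X Y f K k"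
    and ex_cokernel: "\<lbrakk>X \<in> Obj C; Y \<in> Obj C; f \<in> Hom C X Y\<rbrakk> \<Longrightarrow> \<exists>Q q. is_cokernel C X Y f Q q"
    and mono_normal: "\<lbrakk>X \<in> Obj C; Y \<in> Obj C; is_mono C X Y f\<rbrakk>
      \<Longrightarrow> \<exists>Z \<in> Obj C. \<exists>g \<in> Hom C Y Z. is_kernel C Y Z g X f"
    and epi_normal: "\<lbrakk>X \<in> Obj C; Y \<in> Obj C; is_epi C X Y f\<rbrakk>
      \<Longrightarrow> \<exists>Z \<in> Obj C. \<exists>g \<in> Hom C Z X. is_cokernel C Z X g Y f"

definition short_exact ::
  "('o, 'm, 'x) preadditive_category_scheme \<Rightarrow> 'o \<Rightarrow> 'o \<Rightarrow> 'o \<Rightarrow> 'm \<Rightarrow> 'm \<Rightarrow> bool" where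
  "short_exact C X Y Z f g \<longleftrightarrow> is_kernel C Y Z g X f \<and> is_cokernel C X Y f Z g"

definition simple_object :: "('o, 'm, 'x) preadditive_category_scheme \<Rightarrow> 'o \<Rightarrow> bool" where
  "simple_object C X \<longleftrightarrow> X \<in> Obj C \<and> \<not> zero_object C X \<and>
     (\<forall>Y \<in> Obj C. \<forall>f. is_mono C Y X f \<longrightarrow> zero_object C Y \<or> is_iso C Y X f)"

text \<open>
  A composition series \<open>0 = F 0 \<subseteq> \<dots> \<subseteq> F n = X\<close>: each \<open>F k\<close> is a subobject of
  \<open>F (k + 1)\<close> with simple quotient.
\<close>

definition finite_length_object :: "('o, 'm, 'x) preadditive_category_scheme \<Rightarrow> 'o \<Rightarrow> bool" where
  "finite_length_object C X \<longleftrightarrow>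
     (\<exists>(n::nat) F. (\<forall>k \<le> n. F k \<in> Obj C) \<and> zero_object C (F 0) \<and> F n = X \<and>
        (\<forall>k < n. \<exists>S f g. simple_object C S \<and> short_exact C (F k) (F (Suc k)) S f g))"

definition finite_length_category :: "('o, 'm, 'x) preadditive_category_scheme \<Rightarrow> bool" where
  "finite_length_category C \<longleftrightarrow> (\<forall>X \<in> Obj C. finite_length_object C X)"

definition end_ring :: "('o, 'm, 'x) preadditive_category_scheme \<Rightarrow> 'o \<Rightarrow> 'm ring" where
  "end_ring C X = \<lparr>carrier = Hom C X X, monoid.mult = Comp C, one = Ident C X,
     zero = ZeroHom C X X, add = AddHom C\<rparr>"

locale division_ring = ring R for R (structure) +
  assumes one_not_zero: "\<one> \<noteq> \<zero>"
    and division_ring_Units: "Units R = carrier R - {\<zero>}"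


section \<open>Triangulated categories\<close>

text \<open>
  The translation is a strict action of the integers: \<open>ShiftObj D n X\<close> is \<open>X[n]\<close> and
  \<open>ShiftHom D n f\<close> is \<open>f[n]\<close>. A tuple \<open>(X, Y, Z, f, g, h)\<close> in \<open>Triangles D\<close> is a
  distinguished triangle \<open>X \<rightarrow> Y \<rightarrow> Z \<rightarrow> X[1]\<close> with maps \<open>f\<close>, \<open>g\<close>, \<open>h\<close>.
\<close>

record ('o, 'm) triangulated_category = "('o, 'm) preadditive_category" +
  ShiftObj :: "int \<Rightarrow> 'o \<Rightarrow> 'o"
  ShiftHom :: "int \<Rightarrow> 'm \<Rightarrow> 'm"
  Triangles :: "('o \<times> 'o \<times> 'o \<times> 'm \<times> 'm \<times> 'm) set"

definition is_candidate_triangle ::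
  "('o, 'm, 'x) triangulated_category_scheme \<Rightarrow> 'o \<Rightarrow> 'o \<Rightarrow> 'o \<Rightarrow> 'm \<Rightarrow> 'm \<Rightarrow> 'm \<Rightarrow> bool" where
  "is_candidate_triangle D X Y Z f g h \<longleftrightarrow>
     X \<in> Obj D \<and> Y \<in> Obj D \<and> Z \<in> Obj D \<and>
     f \<in> Hom D X Y \<and> g \<in> Hom D Y Z \<and> h \<in> Hom D Z (ShiftObj D 1 X)"

locale triangulated_category = additive_category D
  for D :: "('o, 'm, 'x) triangulated_category_scheme" (structure) +
  assumes ShiftObj_in: "X \<in> Obj D \<Longrightarrow> ShiftObj D n X \<in> Obj D"
    and ShiftHom_in: "\<lbrakk>X \<in> Obj D; Y \<in> Obj D; f \<in> Hom D X Y\<rbrakk>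
      \<Longrightarrow> ShiftHom D n f \<in> Hom D (ShiftObj D n X) (ShiftObj D n Y)"
    and ShiftHom_Ident: "X \<in> Obj D \<Longrightarrow> ShiftHom D n (Ident D X) = Ident D (ShiftObj D n X)"
    and ShiftHom_Comp: "\<lbrakk>X \<in> Obj D; Y \<in> Obj D; Z \<in> Obj D; f \<in> Hom D X Y; g \<in> Hom D Y Z\<rbrakk>
      \<Longrightarrow> ShiftHom D n (g \<cdot> f) = ShiftHom D n g \<cdot> ShiftHom D n f"
    and ShiftHom_add: "\<lbrakk>X \<in> Obj D; Y \<in> Obj D; f \<in> Hom D X Y; g \<in> Hom D X Y\<rbrakk>
      \<Longrightarrow> ShiftHom D n (f \<boxplus> g) = ShiftHom D n f \<boxplus> ShiftHom D n g"
    and ShiftObj_0: "X \<in> Obj D \<Longrightarrow> ShiftObj D 0 X = X"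
    and ShiftObj_add: "X \<in> Obj D \<Longrightarrow> ShiftObj D (m + n) X = ShiftObj D m (ShiftObj D n X)"
    and ShiftHom_0: "\<lbrakk>X \<in> Obj D; Y \<in> Obj D; f \<in> Hom D X Y\<rbrakk> \<Longrightarrow> ShiftHom D 0 f = f"
    and ShiftHom_add_index: "\<lbrakk>X \<in> Obj D; Y \<in> Obj D; f \<in> Hom D X Y\<rbrakk>
      \<Longrightarrow> ShiftHom D (m + n) f = ShiftHom D m (ShiftHom D n f)"
    and triangle_is_candidate:
      "(X, Y, Z, f, g, h) \<in> Triangles D \<Longrightarrow> is_candidate_triangle D X Y Z f g h"
    and TR1_iso: "\<lbrakk>(X, Y, Z, f, g, h) \<in> Triangles D; is_candidate_triangle D X' Y' Z' f' g' h';
      is_iso D X X' a; is_iso D Y Y' b; is_iso D Z Z' c;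
      b \<cdot> f = f' \<cdot> a; c \<cdot> g = g' \<cdot> b; ShiftHom D 1 a \<cdot> h = h' \<cdot> c\<rbrakk>
      \<Longrightarrow> (X', Y', Z', f', g', h') \<in> Triangles D"
    and TR1_Ident: "\<lbrakk>X \<in> Obj D; zero_object D N\<rbrakk>
      \<Longrightarrow> (X, X, N, Ident D X, ZeroHom D X N, ZeroHom D N (ShiftObj D 1 X)) \<in> Triangles D"
    and TR1_cone: "\<lbrakk>X \<in> Obj D; Y \<in> Obj D; f \<in> Hom D X Y\<rbrakk>
      \<Longrightarrow> \<exists>Z g h. (X, Y, Z, f, g, h) \<in> Triangles D"
    and TR2_rotate: "is_candidate_triangle D X Y Z f g h
      \<Longrightarrow> (X, Y, Z, f, g, h) \<in> Triangles D \<longleftrightarrow>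
        (Y, Z, ShiftObj D 1 X, g, h,
          neg_hom D (ShiftObj D 1 X) (ShiftObj D 1 Y) (ShiftHom D 1 f)) \<in> Triangles D"
    and TR3_morphism: "\<lbrakk>(X, Y, Z, f, g, h) \<in> Triangles D; (X', Y', Z', f', g', h') \<in> Triangles D;
      a \<in> Hom D X X'; b \<in> Hom D Y Y'; b \<cdot> f = f' \<cdot> a\<rbrakk>
      \<Longrightarrow> \<exists>c \<in> Hom D Z Z'. c \<cdot> g = g' \<cdot> b \<and> ShiftHom D 1 a \<cdot> h = h' \<cdot> c"
    and TR4_octahedral: "\<lbrakk>(X, Y, P, f, p, u) \<in> Triangles D; (Y, Z, R, g, r, w) \<in> Triangles D;
      (X, Z, Q, g \<cdot> f, q, v) \<in> Triangles D\<rbrakk>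
      \<Longrightarrow> \<exists>a \<in> Hom D P Q. \<exists>b \<in> Hom D Q R.
        (P, Q, R, a, b, ShiftHom D 1 p \<cdot> w) \<in> Triangles D \<and>
        a \<cdot> p = q \<cdot> g \<and> v \<cdot> a = u \<and> b \<cdot> q = r \<and> w \<cdot> b = ShiftHom D 1 f \<cdot> v"


section \<open>Bounded t-structures\<close>

text \<open>
  For \<open>L\<close> and \<open>G\<close> the two halves of a t-structure in cohomological degrees \<open>\<le> 0\<close> and
  \<open>\<ge> 0\<close>, \<open>shifted D L n\<close> and \<open>shifted D G n\<close> are the halves in degrees \<open>\<le> n\<close>
  and \<open>\<ge> n\<close>.
\<close>

definition shifted :: "('o, 'm, 'x) triangulated_category_scheme \<Rightarrow> 'o set \<Rightarrow> int \<Rightarrow> 'o set" where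
  "shifted D A n = ShiftObj D (- n) ` A"

definition t_interval ::
  "('o, 'm, 'x) triangulated_category_scheme \<Rightarrow> 'o set \<Rightarrow> 'o set \<Rightarrow> int \<Rightarrow> int \<Rightarrow> 'o set" where
  "t_interval D L G m n = shifted D L n \<inter> shifted D G m"

definition t_structure ::
  "('o, 'm, 'x) triangulated_category_scheme \<Rightarrow> 'o set \<Rightarrow> 'o set \<Rightarrow> bool" where
  "t_structure D L G \<longleftrightarrow>
     strict_subcategory D L \<and> strict_subcategory D G \<and>
     L \<subseteq> shifted D L 1 \<and> shifted D G 1 \<subseteq> G \<and>
     (\<forall>X \<in> L. \<forall>Y \<in> shifted D G 1. Hom D X Y = {ZeroHom D X Y}) \<and>
     (\<forall>X \<in> Obj D. \<exists>A \<in> L. \<exists>B \<in> shifted D G 1. \<exists>f g h. (A, X, B, f, g, h) \<in> Triangles D)"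

definition bounded_t_structure ::
  "('o, 'm, 'x) triangulated_category_scheme \<Rightarrow> 'o set \<Rightarrow> 'o set \<Rightarrow> bool" where
  "bounded_t_structure D L G \<longleftrightarrow>
     t_structure D L G \<and> (\<forall>X \<in> Obj D. \<exists>m n. X \<in> t_interval D L G m n)"


section \<open>Semibricks and wide subcategories\<close>

definition no_negative_homs :: "('o, 'm, 'x) triangulated_category_scheme \<Rightarrow> 'o set \<Rightarrow> bool" where
  "no_negative_homs D A \<longleftrightarrow>
     (\<forall>X \<in> A. \<forall>Y \<in> A. \<forall>i < 0. Hom D X (ShiftObj D i Y) = {ZeroHom D X (ShiftObj D i Y)})"

text \<open>
  A collection of objects considered up to isomorphism is represented by the set of all objects
  isomorphic to one of its members. Two collections agree up to isomorphism if and only if these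
  sets are equal, and distinct members of the collection are non-isomorphic objects of the set.
\<close>

definition semibrick ::
  "('o, 'm, 'x) triangulated_category_scheme \<Rightarrow> 'o set \<Rightarrow> 'o set \<Rightarrow> nat \<Rightarrow> 'o set \<Rightarrow> bool" where
  "semibrick D L G d \<S> \<longleftrightarrow>
     \<S> \<subseteq> t_interval D L G (- int d + 1) 0 \<and>
     (\<forall>X \<in> \<S>. \<forall>Y \<in> Obj D. isomorphic D X Y \<longrightarrow> Y \<in> \<S>) \<and>
     (\<forall>X \<in> \<S>. division_ring (end_ring D X)) \<and>
     no_negative_homs D \<S> \<and>
     (\<forall>X \<in> \<S>. \<forall>Y \<in> \<S>. \<not> isomorphic D X Y \<longrightarrow> Hom D X Y = {ZeroHom D X Y})"

definition extension_closed :: "('o, 'm, 'x) triangulated_category_scheme \<Rightarrow> 'o set \<Rightarrow> bool" where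
  "extension_closed D W \<longleftrightarrow>
     (\<forall>A Z B f g h. (A, Z, B, f, g, h) \<in> Triangles D \<and> A \<in> W \<and> B \<in> W \<longrightarrow> Z \<in> W)"

definition wide_subcategory ::
  "('o, 'm, 'x) triangulated_category_scheme \<Rightarrow> 'o set \<Rightarrow> 'o set \<Rightarrow> nat \<Rightarrow> 'o set \<Rightarrow> bool" where
  "wide_subcategory D L G d W \<longleftrightarrow>
     strict_subcategory D W \<and>
     W \<subseteq> t_interval D L G (- int d + 1) 0 \<and>
     extension_closed D W \<and>
     no_negative_homs D W \<and>
     abelian_category (full_subcategory D W) \<and>
     (\<forall>X \<in> W. \<forall>Y \<in> W. \<forall>Z \<in> W. \<forall>f \<in> Hom D X Y. \<forall>g \<in> Hom D Y Z.
        short_exact (full_subcategory D W) X Y Z f g \<longleftrightarrow>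
        (\<exists>h. (X, Y, Z, f, g, h) \<in> Triangles D))"

definition finite_length_wide_subcategory ::
  "('o, 'm, 'x) triangulated_category_scheme \<Rightarrow> 'o set \<Rightarrow> 'o set \<Rightarrow> nat \<Rightarrow> 'o set \<Rightarrow> bool" where
  "finite_length_wide_subcategory D L G d W \<longleftrightarrow>
     wide_subcategory D L G d W \<and> finite_length_category (full_subcategory D W)"

end

theory Submission imports Defs begin

text \<open>
  The bijection sends a semibrick \<open>S\<close> to its closure \<open>filt S\<close> under extensions, that is, to the
  objects built from a zero object by finitely many extensions with members of \<open>S\<close>; its inverse
  sends a finite-length wide subcategory to its simple objects. One composite is soon understood: in
  a finite-length wide subcategory, Schur's lemma shows that the simple objects form a semibrick
  (\<open>simple_objects_semibrick\<close>), and composition series, read as chains of triangles, show that the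
  simple objects generate everything under extensions (\<open>filt_simple_objects\<close>).

  The work lies in showing that \<open>filt S\<close> is abelian. Because there are no morphisms into negative
  shifts, in a triangle \<open>X \<rightarrow> Y \<rightarrow> Z \<rightarrow> X[1]\<close> with corners in \<open>filt S\<close> the first map is a kernel
  of the second and the second a cokernel of the first. Following Beilinson, Bernstein and Deligne,
  an extension-closed subcategory without negative morphisms is therefore abelian, with the triangles
  as its short exact sequences, as soon as every morphism in it is admissible: it factors as
  \<open>X \<rightarrow> I \<rightarrow> Y\<close> where the first map has a cocone, and the second a cone, in the subcategory
  (\<open>abelian_E\<close>, \<open>short_exact_iff_tri\<close>).

  Admissibility in \<open>filt S\<close> is proved by induction on the source (\<open>filt_admissible\<close>). A nonzero
  source \<open>X\<close> is an extension \<open>A \<rightarrow> X \<rightarrow> X'\<close> with \<open>A \<in> S\<close> and \<open>X'\<close> a shorter iterated extension. If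
  \<open>f : X \<rightarrow> Y\<close> vanishes on \<open>A\<close>, it comes from a morphism on \<open>X'\<close>, and the induction hypothesis
  applies. Otherwise \<open>A \<rightarrow> Y\<close> is nonzero. A nonzero morphism from a brick always has its cone \<open>C\<close> in
  \<open>filt S\<close> (\<open>nonzero_from_brick_cone\<close>, which is where the Hom-orthogonality of the bricks enters), so
  both \<open>X\<close> and \<open>Y\<close> can be divided by \<open>A\<close>. The induction hypothesis applies to the induced morphism
  \<open>X' \<rightarrow> C\<close>, and the octahedral axiom lifts its factorization to one of \<open>f\<close>
  (\<open>admissible_lift_quotient\<close>).

  The same filtrations show that every nonzero object of \<open>filt S\<close> receives a monomorphism from a
  brick, whence the simple objects of \<open>filt S\<close> are exactly the members of \<open>S\<close>
  (\<open>simple_objects_filt\<close>). Finally \<open>filt S\<close> stays inside the interval of the t-structure because both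
  halves of a t-structure are Hom-orthogonal complements (\<open>filt_t_interval\<close>).
\<close>


section \<open>Morphisms with fixed source and target\<close>

context category
begin

text \<open>
  Composition is associative and unital only on morphisms between objects. Bundling the membership
  conditions into one predicate lets facts about morphisms be chained by resolution.
\<close>

definition arr :: "'o \<Rightarrow> 'o \<Rightarrow> 'm \<Rightarrow> bool" where
  "arr X Y f \<longleftrightarrow> X \<in> Obj C \<and> Y \<in> Obj C \<and> f \<in> Hom C X Y"

lemma arrI: "\<lbrakk>f \<in> Hom C X Y; X \<in> Obj C; Y \<in> Obj C\<rbrakk> \<Longrightarrow> arr X Y f"
  by (simp add: arr_def)

lemma arrD:
  assumes "arr X Y f" shows "X \<in> Obj C" "Y \<in> Obj C" "f \<in> Hom C X Y"
  using assms by (simp_all add: arr_def)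

lemma arr_Ident: "X \<in> Obj C \<Longrightarrow> arr X X (Ident C X)"
  by (simp add: arr_def Ident_in_Hom)

lemma arr_Comp: "\<lbrakk>arr X Y f; arr Y Z g\<rbrakk> \<Longrightarrow> arr X Z (g \<cdot> f)"
  by (auto simp: arr_def intro: Comp_in_Hom)

lemma arr_assoc: "\<lbrakk>arr W X f; arr X Y g; arr Y Z h\<rbrakk> \<Longrightarrow> h \<cdot> g \<cdot> f = h \<cdot> (g \<cdot> f)"
  by (auto simp: arr_def intro: Comp_assoc)

lemma arr_Ident_left: "arr X Y f \<Longrightarrow> Ident C Y \<cdot> f = f"
  by (auto simp: arr_def intro: Comp_Ident_left)

lemma arr_Ident_right: "arr X Y f \<Longrightarrow> f \<cdot> Ident C X = f"
  by (auto simp: arr_def intro: Comp_Ident_right)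

lemma is_isoI:
  assumes "arr X Y f" "arr Y X g" "g \<cdot> f = Ident C X" "f \<cdot> g = Ident C Y"
  shows "is_iso C X Y f"
  using assms unfolding is_iso_def arr_def by blast

lemma is_isoE:
  assumes "is_iso C X Y f" "X \<in> Obj C" "Y \<in> Obj C"
  obtains g where "arr X Y f" "arr Y X g" "g \<cdot> f = Ident C X" "f \<cdot> g = Ident C Y" "is_iso C Y X g"
proof -
  obtain g where g: "f \<in> Hom C X Y" "g \<in> Hom C Y X" "g \<cdot> f = Ident C X" "f \<cdot> g = Ident C Y"
    using assms(1) unfolding is_iso_def by blast
  have "is_iso C Y X g" unfolding is_iso_def using g by blast
  with g that assms show thesis by (simp add: arr_def)
qed

lemma is_iso_Ident: "X \<in> Obj C \<Longrightarrow> is_iso C X X (Ident C X)"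
  using arr_Ident arr_Ident_left is_isoI by metis

lemma is_iso_Comp:
  assumes f: "is_iso C X Y f" and g: "is_iso C Y Z g"
    and o: "X \<in> Obj C" "Y \<in> Obj C" "Z \<in> Obj C"
  shows "is_iso C X Z (g \<cdot> f)"
proof -
  obtain f' where f': "arr X Y f" "arr Y X f'" "f' \<cdot> f = Ident C X" "f \<cdot> f' = Ident C Y"
    using is_isoE[OF f o(1,2)] .
  obtain g' where g': "arr Y Z g" "arr Z Y g'" "g' \<cdot> g = Ident C Y" "g \<cdot> g' = Ident C Z"
    using is_isoE[OF g o(2,3)] .
  show ?thesis
  proof (rule is_isoI)
    show "arr X Z (g \<cdot> f)" "arr Z X (f' \<cdot> g')" using f' g' arr_Comp by blast+
    have "f' \<cdot> g' \<cdot> (g \<cdot> f) = f' \<cdot> (g' \<cdot> g \<cdot> f)"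
      using arr_assoc[OF arr_Comp[OF f'(1) g'(1)] g'(2) f'(2)] arr_assoc[OF f'(1) g'(1,2)] by simp
    then show "f' \<cdot> g' \<cdot> (g \<cdot> f) = Ident C X" using f' g' by (simp add: arr_Ident_left)
    have "g \<cdot> f \<cdot> (f' \<cdot> g') = g \<cdot> (f \<cdot> f' \<cdot> g')"
      using arr_assoc[OF arr_Comp[OF g'(2) f'(2)] f'(1) g'(1)] arr_assoc[OF g'(2) f'(2,1)] by simp
    then show "g \<cdot> f \<cdot> (f' \<cdot> g') = Ident C Z" using f' g' by (simp add: arr_Ident_left)
  qed
qed

lemma isomorphic_sym:
  assumes "isomorphic C X Y" "X \<in> Obj C" "Y \<in> Obj C"
  shows "isomorphic C Y X"
  using assms is_isoE unfolding isomorphic_def by metis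

lemma is_monoD:
  assumes "is_mono C X Y f" "arr W X u" "arr W X v" "f \<cdot> u = f \<cdot> v"
  shows "u = v"
  using assms unfolding is_mono_def arr_def by blast

lemma is_mono_split_epi_is_iso:
  assumes m: "is_mono C X Y f" and f: "arr X Y f" and g: "arr Y X g" and fg: "f \<cdot> g = Ident C Y"
  shows "is_iso C X Y f"
proof (rule is_isoI[OF f g _ fg])
  have "f \<cdot> (g \<cdot> f) = f \<cdot> Ident C X"
    using f g fg by (metis arr_assoc arr_Ident_left arr_Ident_right)
  then show "g \<cdot> f = Ident C X"
    using is_monoD[OF m] f g by (meson arr_Comp arr_Ident arrD(1))
qed

lemma is_iso_one_sided:
  assumes f: "arr X Y f" and g: "arr Y X g" "g \<cdot> f = Ident C X" and h: "arr Y X h" "f \<cdot> h = Ident C Y"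
  shows "is_iso C X Y f"
proof (rule is_isoI[OF f g(1,2)])
  have "g = g \<cdot> (f \<cdot> h)" using h g arr_Ident_right by simp
  also have "\<dots> = h" using arr_assoc[OF h(1) f g(1)] g h arr_Ident_left by simp
  finally show "f \<cdot> g = Ident C Y" using h by simp
qed

end


section \<open>Preadditive and abelian categories\<close>

context preadditive_category
begin

lemma hom_group_simps [simp]:
  "carrier (hom_group C X Y) = Hom C X Y"
  "monoid.mult (hom_group C X Y) = AddHom C"
  "one (hom_group C X Y) = ZeroHom C X Y"
  by (simp_all add: hom_group_def)

lemma hom_group:
  assumes "X \<in> Obj C" "Y \<in> Obj C" shows "comm_group (hom_group C X Y)" "group (hom_group C X Y)"
  using comm_group_hom_group[OF assms] by (auto simp: comm_group.axioms)

lemma arr_Zero: "\<lbrakk>X \<in> Obj C; Y \<in> Obj C\<rbrakk> \<Longrightarrow> arr X Y (ZeroHom C X Y)"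
  using monoid.one_closed[OF group.is_monoid[OF hom_group(2)]] by (simp add: arr_def)

lemma arr_add: "\<lbrakk>arr X Y f; arr X Y g\<rbrakk> \<Longrightarrow> arr X Y (f \<boxplus> g)"
  using monoid.m_closed[OF group.is_monoid[OF hom_group(2)]] by (simp add: arr_def)

lemma arr_neg: "arr X Y f \<Longrightarrow> arr X Y (neg_hom C X Y f)"
  using group.inv_closed[OF hom_group(2)] by (simp add: arr_def neg_hom_def)

lemma add_neg: "arr X Y f \<Longrightarrow> f \<boxplus> neg_hom C X Y f = ZeroHom C X Y"
  using group.r_inv[OF hom_group(2)] by (simp add: arr_def neg_hom_def)

lemma add_zero_right: "arr X Y f \<Longrightarrow> f \<boxplus> ZeroHom C X Y = f"
  using monoid.r_one[OF group.is_monoid[OF hom_group(2)]] by (simp add: arr_def)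

lemma add_zero_left: "arr X Y f \<Longrightarrow> ZeroHom C X Y \<boxplus> f = f"
  using monoid.l_one[OF group.is_monoid[OF hom_group(2)]] by (simp add: arr_def)

lemma add_right_cancel:
  assumes "arr X Y f" "arr X Y g" "arr X Y h" "f \<boxplus> h = g \<boxplus> h" shows "f = g"
  using assms group.right_cancel[OF hom_group(2)[of X Y], of h f g] by (simp add: arr_def)

lemma add_left_cancel:
  assumes "arr X Y f" "arr X Y g" "arr X Y h" "h \<boxplus> f = h \<boxplus> g" shows "f = g"
  using assms monoid.Units_l_cancel[OF group.is_monoid[OF hom_group(2)[of X Y]], of h f g] group.Units_eq[OF hom_group(2)[of X Y]] by (simp add: arr_def)

lemma neg_unique:
  assumes "arr X Y f" "arr X Y g" "f \<boxplus> g = ZeroHom C X Y" shows "g = neg_hom C X Y f"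
  using assms add_left_cancel add_neg arr_neg by metis

lemma neg_neg: "arr X Y f \<Longrightarrow> neg_hom C X Y (neg_hom C X Y f) = f"
  using group.inv_inv[OF hom_group(2)] by (simp add: arr_def neg_hom_def)

lemma Zero_unique: "\<lbrakk>arr X Y f; f \<boxplus> f = f\<rbrakk> \<Longrightarrow> f = ZeroHom C X Y"
  using add_left_cancel add_zero_right arr_Zero arrD by metis

lemma arr_distrib_left:
  "\<lbrakk>arr X Y f; arr X Y g; arr Y Z h\<rbrakk> \<Longrightarrow> h \<cdot> (f \<boxplus> g) = (h \<cdot> f) \<boxplus> (h \<cdot> g)"
  using Comp_add_right[of X Y Z f g h] by (simp add: arr_def)

lemma arr_distrib_right:
  "\<lbrakk>arr X Y f; arr Y Z g; arr Y Z h\<rbrakk> \<Longrightarrow> (g \<boxplus> h) \<cdot> f = (g \<cdot> f) \<boxplus> (h \<cdot> f)"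
  using Comp_add_left[of X Y Z f g h] by (simp add: arr_def)

lemma Comp_Zero_right:
  assumes "arr Y Z g" "X \<in> Obj C" shows "g \<cdot> ZeroHom C X Y = ZeroHom C X Z"
proof (rule Zero_unique)
  have z: "arr X Y (ZeroHom C X Y)" using assms arr_Zero arrD by metis
  then show "arr X Z (g \<cdot> ZeroHom C X Y)" using assms arr_Comp by blast
  show "(g \<cdot> ZeroHom C X Y) \<boxplus> (g \<cdot> ZeroHom C X Y) = g \<cdot> ZeroHom C X Y"
    using arr_distrib_left[OF z z assms(1)] add_zero_right[OF z] by simp
qed

lemma Comp_Zero_left:
  assumes "arr X Y f" "Z \<in> Obj C" shows "ZeroHom C Y Z \<cdot> f = ZeroHom C X Z"
proof (rule Zero_unique)
  have z: "arr Y Z (ZeroHom C Y Z)" using assms arr_Zero arrD by metis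
  then show "arr X Z (ZeroHom C Y Z \<cdot> f)" using assms arr_Comp by blast
  show "(ZeroHom C Y Z \<cdot> f) \<boxplus> (ZeroHom C Y Z \<cdot> f) = ZeroHom C Y Z \<cdot> f"
    using arr_distrib_right[OF assms(1) z z] add_zero_right[OF z] by simp
qed

lemma Comp_neg_right:
  assumes "arr X Y f" "arr Y Z g" shows "g \<cdot> neg_hom C X Y f = neg_hom C X Z (g \<cdot> f)"
proof (rule neg_unique)
  show "arr X Z (g \<cdot> f)" "arr X Z (g \<cdot> neg_hom C X Y f)" using assms arr_Comp arr_neg by blast+
  show "g \<cdot> f \<boxplus> (g \<cdot> neg_hom C X Y f) = ZeroHom C X Z"
    using arr_distrib_left[of X Y f "neg_hom C X Y f"] assms
    by (metis Comp_Zero_right add_neg arr_neg arrD(1))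
qed

lemma Comp_neg_left:
  assumes "arr X Y f" "arr Y Z g" shows "neg_hom C Y Z g \<cdot> f = neg_hom C X Z (g \<cdot> f)"
proof (rule neg_unique)
  show "arr X Z (g \<cdot> f)" "arr X Z (neg_hom C Y Z g \<cdot> f)" using assms arr_Comp arr_neg by blast+
  show "g \<cdot> f \<boxplus> (neg_hom C Y Z g \<cdot> f) = ZeroHom C X Z"
    using arr_distrib_right[of X Y f Z g "neg_hom C Y Z g"] assms
    by (metis Comp_Zero_left add_neg arr_neg arrD(2))
qed

text \<open>
  Cancellation follows from the case of zero by passing to the difference of the two morphisms. The
  source \<open>T\<close> is fixed, since in a triangulated category a morphism can usually be cancelled only
  against certain sources.
\<close>

lemma left_cancel_if_zero:
  assumes f: "arr Y Z f" and u: "arr T Y u" and v: "arr T Y v" and eq: "f \<cdot> u = f \<cdot> v"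
    and zero: "\<And>w. \<lbrakk>arr T Y w; f \<cdot> w = ZeroHom C T Z\<rbrakk> \<Longrightarrow> w = ZeroHom C T Y"
  shows "u = v"
proof -
  let ?n = "neg_hom C T Y v"
  have "f \<cdot> (u \<boxplus> ?n) = f \<cdot> (v \<boxplus> ?n)"
    using arr_distrib_left[OF u arr_neg[OF v] f] arr_distrib_left[OF v arr_neg[OF v] f] eq by simp
  then have "f \<cdot> (u \<boxplus> ?n) = ZeroHom C T Z"
    using add_neg[OF v] Comp_Zero_right[OF f] arrD(1)[OF u] by simp
  then have "u \<boxplus> ?n = v \<boxplus> ?n"
    using zero arr_add[OF u arr_neg[OF v]] add_neg[OF v] by simp
  then show ?thesis using add_right_cancel[OF u v arr_neg[OF v]] by blast
qed

lemma right_cancel_if_zero: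
  assumes f: "arr X Y f" and u: "arr Y T u" and v: "arr Y T v" and eq: "u \<cdot> f = v \<cdot> f"
    and zero: "\<And>w. \<lbrakk>arr Y T w; w \<cdot> f = ZeroHom C X T\<rbrakk> \<Longrightarrow> w = ZeroHom C Y T"
  shows "u = v"
proof -
  let ?n = "neg_hom C Y T v"
  have "(u \<boxplus> ?n) \<cdot> f = (v \<boxplus> ?n) \<cdot> f"
    using arr_distrib_right[OF f u arr_neg[OF v]] arr_distrib_right[OF f v arr_neg[OF v]] eq by simp
  then have "(u \<boxplus> ?n) \<cdot> f = ZeroHom C X T"
    using add_neg[OF v] Comp_Zero_left[OF f] arrD(2)[OF u] by simp
  then have "u \<boxplus> ?n = v \<boxplus> ?n"
    using zero arr_add[OF u arr_neg[OF v]] add_neg[OF v] by simp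
  then show ?thesis using add_right_cancel[OF u v arr_neg[OF v]] by blast
qed

lemma zero_objectD:
  assumes "zero_object C N"
  shows "N \<in> Obj C" "arr X N f \<Longrightarrow> f = ZeroHom C X N" "arr N X f \<Longrightarrow> f = ZeroHom C N X"
  using assms arr_Zero unfolding zero_object_def arr_def by blast+

lemma zero_objectI:
  assumes "N \<in> Obj C" "Ident C N = ZeroHom C N N" shows "zero_object C N"
  unfolding zero_object_def
proof (intro conjI ballI)
  show "N \<in> Obj C" by fact
  fix X assume X: "X \<in> Obj C"
  have "f = ZeroHom C X N" if "f \<in> Hom C X N" for f
    using that X assms by (metis arrI arr_Ident_left Comp_Zero_left)
  then show "\<exists>!f. f \<in> Hom C X N" using arr_Zero[OF X assms(1)] arrD(3) by blast
  have "f = ZeroHom C N X" if "f \<in> Hom C N X" for f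
    using that X assms by (metis arrI arr_Ident_right Comp_Zero_right)
  then show "\<exists>!f. f \<in> Hom C N X" using arr_Zero[OF assms(1) X] arrD(3) by blast
qed

lemma zero_object_iff: "zero_object C N \<longleftrightarrow> N \<in> Obj C \<and> Ident C N = ZeroHom C N N"
  using zero_objectI zero_objectD arr_Ident by metis

lemma is_iso_zero_objects:
  assumes "zero_object C N" "zero_object C M"
  shows "is_iso C N M (ZeroHom C N M)"
proof (rule is_isoI)
  note o = zero_objectD(1)[OF assms(1)] zero_objectD(1)[OF assms(2)]
  show 1: "arr N M (ZeroHom C N M)" "arr M N (ZeroHom C M N)" using o arr_Zero by blast+
  show "ZeroHom C M N \<cdot> ZeroHom C N M = Ident C N" "ZeroHom C N M \<cdot> ZeroHom C M N = Ident C M"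
    using 1 o assms by (metis zero_object_iff Comp_Zero_right)+
qed

lemma zero_object_isomorphic:
  assumes "zero_object C N" "isomorphic C N M" "M \<in> Obj C"
  shows "zero_object C M"
proof (rule zero_objectI)
  have N: "N \<in> Obj C" using assms zero_objectD by blast
  obtain f g where f: "arr N M f" "arr M N g" "f \<cdot> g = Ident C M"
    using assms N is_isoE unfolding isomorphic_def by metis
  then have "f = ZeroHom C N M" using zero_objectD(3)[OF assms(1)] by blast
  then show "Ident C M = ZeroHom C M M" using f Comp_Zero_left assms(3) by metis
qed fact

lemma is_kernel_is_mono:
  assumes k: "is_kernel C X Y f K k" and X: "X \<in> Obj C" and Y: "Y \<in> Obj C" and f: "f \<in> Hom C X Y"
  shows "is_mono C K X k"
  unfolding is_mono_def
proof (intro conjI ballI impI)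
  show "k \<in> Hom C K X" using k by (simp add: is_kernel_def)
  have K: "K \<in> Obj C" and ak: "arr K X k" and fk: "f \<cdot> k = ZeroHom C K Y"
    using k X by (simp_all add: is_kernel_def arr_def)
  fix T u v assume T: "T \<in> Obj C" and u: "u \<in> Hom C T K" and v: "v \<in> Hom C T K" and eq: "k \<cdot> u = k \<cdot> v"
  have au: "arr T K u" using T u K by (simp add: arr_def)
  have "f \<cdot> (k \<cdot> u) = ZeroHom C T Y"
    using arr_assoc[OF au ak, of Y f] X Y f fk Comp_Zero_left[OF au Y] by (simp add: arr_def)
  then have "\<exists>!w. w \<in> Hom C T K \<and> k \<cdot> w = k \<cdot> u"
    using k T arrD(3)[OF arr_Comp[OF au ak]] unfolding is_kernel_def by blast
  then show "u = v" using u v eq by metis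
qed

text \<open>
  The comparison isomorphism is compatible with the projections; this lets a triangle on one cokernel
  be transported to another.
\<close>

lemma cokernel_unique:
  assumes q: "is_cokernel C X Y f Q q" and q': "is_cokernel C X Y f Q' q'" and Y: "Y \<in> Obj C"
  shows "\<exists>\<phi>. is_iso C Q Q' \<phi> \<and> \<phi> \<cdot> q = q'"
proof -
  have factor: "\<exists>\<phi>. arr Q Q' \<phi> \<and> \<phi> \<cdot> q = q'"
    if "is_cokernel C X Y f Q q" "is_cokernel C X Y f Q' q'" for Q q Q' q'
    using that unfolding is_cokernel_def arr_def by blast
  have unique: "\<phi> = Ident C Q" if q: "is_cokernel C X Y f Q q" and p: "arr Q Q \<phi>" "\<phi> \<cdot> q = q" for Q q \<phi>
  proof -
    have Q: "Q \<in> Obj C" "arr Y Q q" "q \<cdot> f = ZeroHom C X Q" using q Y by (simp_all add: is_cokernel_def arr_def)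
    have "\<exists>!v. v \<in> Hom C Q Q \<and> v \<cdot> q = q" using q Q unfolding is_cokernel_def by blast
    then show ?thesis using p Q arr_Ident_left Ident_in_Hom arrD(3) by metis
  qed
  obtain a where a: "arr Q Q' a" "a \<cdot> q = q'" using factor[OF q q'] by blast
  obtain b where b: "arr Q' Q b" "b \<cdot> q' = q" using factor[OF q' q] by blast
  have "arr Y Q q" "arr Y Q' q'" using q q' Y by (simp_all add: is_cokernel_def arr_def)
  then have "b \<cdot> a \<cdot> q = q" "a \<cdot> b \<cdot> q' = q'" using arr_assoc a b by metis+
  then show ?thesis using is_isoI[OF a(1) b(1)] unique q q' arr_Comp a b by blast
qed

lemma end_ring_simps [simp]:
  "carrier (end_ring C X) = Hom C X X" "monoid.mult (end_ring C X) = Comp C"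
  "one (end_ring C X) = Ident C X" "zero (end_ring C X) = ZeroHom C X X" "add (end_ring C X) = AddHom C"
  by (simp_all add: end_ring_def)

lemma ring_end_ring:
  assumes X: "X \<in> Obj C" shows "ring (end_ring C X)"
proof -
  interpret G: comm_group "hom_group C X X" using comm_group_hom_group[OF X X] .
  show ?thesis
  proof (rule ringI)
    show "abelian_group (end_ring C X)"
    proof (rule abelian_groupI, simp_all)
      fix x assume "x \<in> Hom C X X"
      then show "\<exists>y\<in>Hom C X X. y \<boxplus> x = ZeroHom C X X" using G.l_inv_ex[of x] by simp
    qed (use G.m_closed G.m_assoc G.m_comm G.one_closed G.l_one in simp_all)
    show "Group.monoid (end_ring C X)"
      using X by (intro monoidI) (auto simp: Ident_in_Hom Comp_Ident_left Comp_Ident_right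
        intro: Comp_in_Hom Comp_assoc)
  qed (use X Comp_add_left Comp_add_right in auto)
qed

lemma Units_end_ring: "X \<in> Obj C \<Longrightarrow> Units (end_ring C X) = {f. is_iso C X X f}"
  by (auto simp: Units_def is_iso_def)

text \<open>
  The zero ring corresponds to a zero object, since \<open>1 = 0\<close> in the endomorphism ring says that the
  identity is the zero morphism.
\<close>

lemma division_ring_end_ring_iff:
  assumes X: "X \<in> Obj C"
  shows "division_ring (end_ring C X) \<longleftrightarrow>
    \<not> zero_object C X \<and> (\<forall>f. arr X X f \<longrightarrow> f \<noteq> ZeroHom C X X \<longrightarrow> is_iso C X X f)"
    (is "?L \<longleftrightarrow> ?R")
proof
  assume ?L
  then interpret R: division_ring "end_ring C X" .
  show ?R
    using R.one_not_zero R.division_ring_Units Units_end_ring[OF X] zero_object_iff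
    by (auto simp: arr_def)
next
  assume r: ?R
  then have nz: "Ident C X \<noteq> ZeroHom C X X" using zero_object_iff X by blast
  have nonzero: "f \<noteq> ZeroHom C X X" if i: "is_iso C X X f" for f
  proof
    assume f: "f = ZeroHom C X X"
    obtain g where "arr X X g" "g \<cdot> f = Ident C X" using is_isoE[OF i X X] by metis
    then show False using f nz Comp_Zero_right X by metis
  qed
  have "Units (end_ring C X) = carrier (end_ring C X) - {\<zero>\<^bsub>end_ring C X\<^esub>}"
    unfolding Units_end_ring[OF X]
  proof (intro equalityI subsetI)
    fix f assume "f \<in> {f. is_iso C X X f}"
    then show "f \<in> carrier (end_ring C X) - {\<zero>\<^bsub>end_ring C X\<^esub>}" using nonzero by (simp add: is_iso_def)
  next
    fix f assume "f \<in> carrier (end_ring C X) - {\<zero>\<^bsub>end_ring C X\<^esub>}"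
    then show "f \<in> {f. is_iso C X X f}" using r arrI[OF _ X X] by simp
  qed
  then show ?L
    using ring_end_ring[OF X] nz by (simp add: division_ring_def division_ring_axioms_def)
qed

lemma is_mono_iso_Comp:
  assumes m: "is_mono C T Y f" and i: "is_iso C Y X i" and o: "T \<in> Obj C" "Y \<in> Obj C" "X \<in> Obj C"
  shows "is_mono C T X (i \<cdot> f)"
  unfolding is_mono_def
proof (intro conjI ballI impI)
  have f: "arr T Y f" using m o by (simp add: is_mono_def arr_def)
  obtain j where j: "arr Y X i" "arr X Y j" "j \<cdot> i = Ident C Y" using is_isoE[OF i o(2,3)] .
  show "i \<cdot> f \<in> Hom C T X" using arrD(3)[OF arr_Comp[OF f j(1)]] .
  fix V u v assume V: "V \<in> Obj C" "u \<in> Hom C V T" "v \<in> Hom C V T" and eq: "i \<cdot> f \<cdot> u = i \<cdot> f \<cdot> v"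
  have "f \<cdot> w = j \<cdot> (i \<cdot> f \<cdot> w)" if "arr V T w" for w
    using arr_assoc[OF that f j(1)] arr_assoc[OF arr_Comp[OF that f] j(1,2)] j(3)
      arr_Ident_left[OF arr_Comp[OF that f]] by simp
  then have "f \<cdot> u = f \<cdot> v" using eq V o by (metis arrI)
  then show "u = v" using m V unfolding is_mono_def by blast
qed

lemma simple_object_isomorphic:
  assumes X: "simple_object C X" and i: "is_iso C Y X i" and Y: "Y \<in> Obj C"
  shows "simple_object C Y"
  unfolding simple_object_def
proof (intro conjI ballI allI impI)
  have XO: "X \<in> Obj C" using X by (simp add: simple_object_def)
  obtain j where j: "arr Y X i" "arr X Y j" "j \<cdot> i = Ident C Y" "is_iso C X Y j"
    using is_isoE[OF i Y XO] .
  show "Y \<in> Obj C" by fact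
  show "\<not> zero_object C Y"
    using X zero_object_isomorphic[of Y X] i XO unfolding simple_object_def isomorphic_def by blast
  fix T f assume T: "T \<in> Obj C" and m: "is_mono C T Y f"
  then have f: "arr T Y f" using Y by (simp add: is_mono_def arr_def)
  have "f = j \<cdot> (i \<cdot> f)" using arr_assoc[OF f j(1,2)] j(3) arr_Ident_left[OF f] by simp
  then show "zero_object C T \<or> is_iso C T Y f"
    using X T is_mono_iso_Comp[OF m i T Y XO] is_iso_Comp[OF _ j(4) T XO Y]
    unfolding simple_object_def by metis
qed

lemma is_mono_if_zero_kernel:
  assumes f: "arr X Y f" and k: "is_kernel C X Y f K k" and K: "zero_object C K"
  shows "is_mono C X Y f"
  unfolding is_mono_def
proof (intro conjI ballI impI)
  show "f \<in> Hom C X Y" using arrD[OF f] by blast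
  note o = arrD(1,2)[OF f]
  have ak: "arr K X k" using k o by (simp add: is_kernel_def arr_def)
  fix T u v assume T: "T \<in> Obj C" and u: "u \<in> Hom C T X" "v \<in> Hom C T X" and eq: "f \<cdot> u = f \<cdot> v"
  have "w = ZeroHom C T X" if w: "arr T X w" "f \<cdot> w = ZeroHom C T Y" for w
  proof -
    obtain x where x: "x \<in> Hom C T K" "k \<cdot> x = w"
      using k w T arrD(3)[OF w(1)] unfolding is_kernel_def by blast
    then have "x = ZeroHom C T K" using zero_objectD(2)[OF K arrI] T zero_objectD(1)[OF K] by blast
    then show ?thesis using x Comp_Zero_right[OF ak T] by simp
  qed
  then show "u = v" using left_cancel_if_zero[OF f] arrI u T o eq by metis
qed

end

text \<open>
  The kernel inclusion is a monomorphism into a simple object, and it is not invertible because the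
  morphism is nonzero; hence the kernel is zero. So the morphism is itself a monomorphism, now into a simple
  object from a nonzero one.
\<close>

lemma (in abelian_category) schur:
  assumes X: "simple_object C X" and Y: "simple_object C Y" and f: "arr X Y f" "f \<noteq> ZeroHom C X Y"
  shows "is_iso C X Y f"
proof -
  note o = arrD(1,2)[OF f(1)]
  obtain K k where k: "is_kernel C X Y f K k" using ex_kernel o arrD(3)[OF f(1)] by blast
  have K: "K \<in> Obj C" "f \<cdot> k = ZeroHom C K Y" "arr K X k" using k o by (simp_all add: is_kernel_def arr_def)
  have "is_mono C K X k" using is_kernel_is_mono[OF k o arrD(3)[OF f(1)]] .
  then have "zero_object C K \<or> is_iso C K X k" using X K unfolding simple_object_def by blast
  moreover have "\<not> is_iso C K X k"
  proof
    assume "is_iso C K X k"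
    then obtain g where g: "arr X K g" "k \<cdot> g = Ident C X" using is_isoE K(1) o(1) by metis
    then have "f = f \<cdot> k \<cdot> g" using arr_assoc[OF g(1) K(3) f(1)] arr_Ident_right[OF f(1)] by simp
    then show False using K(2) Comp_Zero_left[OF g(1) o(2)] f(2) by simp
  qed
  ultimately have "is_mono C X Y f" using is_mono_if_zero_kernel[OF f(1) k] by blast
  then show ?thesis using X Y o unfolding simple_object_def by blast
qed

lemma full_subcategory_simps [simp]:
  "Obj (full_subcategory C W) = W"
  "Hom (full_subcategory C W) = Hom C"
  "Comp (full_subcategory C W) = Comp C"
  "Ident (full_subcategory C W) = Ident C"
  by (simp_all add: full_subcategory_def)

lemma full_subcategory_preadditive_simps [simp]:
  "AddHom (full_subcategory C W) = AddHom C"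
  "ZeroHom (full_subcategory C W) = ZeroHom C"
  "hom_group (full_subcategory C W) = hom_group C"
  by (simp_all add: full_subcategory_def hom_group_def fun_eq_iff)

lemma is_iso_full_subcategory [simp]: "is_iso (full_subcategory C W) = is_iso C"
  by (simp add: is_iso_def fun_eq_iff)

lemma (in preadditive_category) preadditive_full_subcategory:
  assumes "W \<subseteq> Obj C" shows "preadditive_category (full_subcategory C W)"
proof -
  have *: "X \<in> Obj C" if "X \<in> W" for X using assms that by blast
  show ?thesis
    by (intro preadditive_category.intro category.intro preadditive_category_axioms.intro; simp;
      blast intro: * Ident_in_Hom Comp_in_Hom Comp_assoc Comp_Ident_left Comp_Ident_right
        comm_group_hom_group Comp_add_left Comp_add_right)
qed

lemma (in preadditive_category) zero_object_full_subcategory: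
  assumes "W \<subseteq> Obj C"
  shows "zero_object (full_subcategory C W) N \<longleftrightarrow> N \<in> W \<and> zero_object C N"
proof -
  interpret E: preadditive_category "full_subcategory C W" using preadditive_full_subcategory[OF assms] .
  show ?thesis using E.zero_object_iff zero_object_iff assms by auto
qed


section \<open>Triangles\<close>

context triangulated_category
begin

abbreviation tri :: "'o \<Rightarrow> 'o \<Rightarrow> 'o \<Rightarrow> 'm \<Rightarrow> 'm \<Rightarrow> 'm \<Rightarrow> bool" where
  "tri X Y Z f g h \<equiv> (X, Y, Z, f, g, h) \<in> Triangles D"

abbreviation shO :: "int \<Rightarrow> 'o \<Rightarrow> 'o" where "shO \<equiv> ShiftObj D"
abbreviation shH :: "int \<Rightarrow> 'm \<Rightarrow> 'm" where "shH \<equiv> ShiftHom D"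

lemma tri_arr:
  assumes "tri X Y Z f g h"
  shows "arr X Y f" "arr Y Z g" "arr Z (shO 1 X) h"
  using triangle_is_candidate[OF assms] ShiftObj_in
  by (auto simp: is_candidate_triangle_def arr_def)

lemma tri_Obj:
  assumes "tri X Y Z f g h"
  shows "X \<in> Obj D" "Y \<in> Obj D" "Z \<in> Obj D"
  using triangle_is_candidate[OF assms] by (auto simp: is_candidate_triangle_def)

lemma candidateI:
  "\<lbrakk>arr X Y f; arr Y Z g; arr Z (shO 1 X) h\<rbrakk> \<Longrightarrow> is_candidate_triangle D X Y Z f g h"
  by (auto simp: is_candidate_triangle_def arr_def)

lemma arr_shift: "arr X Y f \<Longrightarrow> arr (shO n X) (shO n Y) (shH n f)"
  using ShiftHom_in ShiftObj_in by (auto simp: arr_def)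

lemma shift_Comp: "\<lbrakk>arr X Y f; arr Y Z g\<rbrakk> \<Longrightarrow> shH n (g \<cdot> f) = shH n g \<cdot> shH n f"
  using ShiftHom_Comp[of X Y Z f g n] by (simp add: arr_def)

lemma shift_Obj_inverse:
  assumes "X \<in> Obj D" "m + n = 0" shows "shO m (shO n X) = X"
  using ShiftObj_add[OF assms(1), of m n] ShiftObj_0 assms by simp

lemma shift_Obj_inverse1 [simp]:
  assumes "X \<in> Obj D" shows "shO 1 (shO (-1) X) = X" "shO (-1) (shO 1 X) = X"
  using shift_Obj_inverse assms by simp_all

lemma shift_Hom_inverse:
  assumes "arr X Y f" "m + n = 0" shows "shH m (shH n f) = f"
  using ShiftHom_add_index[of X Y f m n] ShiftHom_0[of X Y f] assms by (simp add: arr_def)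

lemma shift_Zero:
  assumes "X \<in> Obj D" "Y \<in> Obj D" shows "shH n (ZeroHom D X Y) = ZeroHom D (shO n X) (shO n Y)"
proof (rule Zero_unique)
  have z: "arr X Y (ZeroHom D X Y)" using assms arr_Zero by blast
  show "arr (shO n X) (shO n Y) (shH n (ZeroHom D X Y))" using arr_shift z by blast
  show "shH n (ZeroHom D X Y) \<boxplus> shH n (ZeroHom D X Y) = shH n (ZeroHom D X Y)"
    using ShiftHom_add[of X Y "ZeroHom D X Y" "ZeroHom D X Y" n] add_zero_right[OF z] assms z arrD(3) by simp
qed

lemma shift_neg:
  assumes "arr X Y f" shows "shH n (neg_hom D X Y f) = neg_hom D (shO n X) (shO n Y) (shH n f)"
proof (rule neg_unique)
  show "arr (shO n X) (shO n Y) (shH n f)" "arr (shO n X) (shO n Y) (shH n (neg_hom D X Y f))"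
    using arr_shift arr_neg assms by blast+
  show "shH n f \<boxplus> shH n (neg_hom D X Y f) = ZeroHom D (shO n X) (shO n Y)"
    using ShiftHom_add[of X Y f "neg_hom D X Y f" n] add_neg arr_neg[OF assms] assms shift_Zero
    by (simp add: arr_def)
qed

lemma shift_is_iso:
  assumes "is_iso D X Y f" "X \<in> Obj D" "Y \<in> Obj D"
  shows "is_iso D (shO n X) (shO n Y) (shH n f)"
proof -
  obtain g where g: "arr X Y f" "arr Y X g" "g \<cdot> f = Ident D X" "f \<cdot> g = Ident D Y"
    using is_isoE[OF assms] .
  show ?thesis
    using is_isoI[OF arr_shift[OF g(1)] arr_shift[OF g(2)]]
      shift_Comp[OF g(1,2)] shift_Comp[OF g(2,1)] g(3,4) ShiftHom_Ident assms by simp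
qed

lemma shift_zero_object: "zero_object D N \<Longrightarrow> zero_object D (shO n N)"
  using ShiftHom_Ident shift_Zero ShiftObj_in by (simp add: zero_object_iff) metis

lemma rotate:
  assumes "tri X Y Z f g h"
  shows "tri Y Z (shO 1 X) g h (neg_hom D (shO 1 X) (shO 1 Y) (shH 1 f))"
  using TR2_rotate triangle_is_candidate[OF assms] assms by blast

text \<open>
  The signs cancel: rotating forward negates the shifted morphism, and the connecting morphism is
  negated here beforehand.
\<close>

lemma rotate_back:
  assumes t: "tri X Y Z f g h"
  shows "tri (shO (-1) Z) X Y (neg_hom D (shO (-1) Z) X (shH (-1) h)) f g"
proof -
  note a = tri_arr[OF t] and o = tri_Obj[OF t]
  have h': "arr (shO (-1) Z) X (shH (-1) h)"
    using arr_shift[OF a(3), of "-1"] o by simp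
  let ?k = "neg_hom D (shO (-1) Z) X (shH (-1) h)"
  have "shH 1 (shH (-1) h) = h" using shift_Hom_inverse[OF a(3)] by simp
  then have "shH 1 ?k = neg_hom D Z (shO 1 X) h" using shift_neg[OF h', of 1] o by simp
  then have eq: "neg_hom D Z (shO 1 X) (shH 1 ?k) = h" using neg_neg[OF a(3)] by simp
  have "is_candidate_triangle D (shO (-1) Z) X Y ?k f g"
    using candidateI arr_neg[OF h'] a(1,2) o by simp
  from TR2_rotate[OF this] show ?thesis using t eq o by simp
qed

text \<open>
  Three backward rotations shift the whole triangle. The signs of its morphisms are left open, as only
  the existence of the triangle matters.
\<close>

lemma tri_shift_down:
  assumes "tri X Y Z f g h"
  shows "\<exists>f' g' h'. tri (shO (-1) X) (shO (-1) Y) (shO (-1) Z) f' g' h'"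
  using rotate_back[OF rotate_back[OF rotate_back[OF assms]]] by blast

lemma tri_Comp_Zero:
  assumes t: "tri X Y Z f g h"
  shows "g \<cdot> f = ZeroHom D X Z" "h \<cdot> g = ZeroHom D Y (shO 1 X)"
proof -
  have *: "g \<cdot> f = ZeroHom D X Z" if t: "tri X Y Z f g h" for X Y Z f g h
  proof -
    note a = tri_arr[OF t] and o = tri_Obj[OF t]
    obtain N where N: "zero_object D N" using ex_zero_object by blast
    \<comment> \<open>Map the triangle on the identity of X, with third corner zero, to the given one.\<close>
    have "\<exists>c\<in>Hom D N Z. c \<cdot> ZeroHom D X N = g \<cdot> f \<and> shH 1 (Ident D X) \<cdot> ZeroHom D N (shO 1 X) = h \<cdot> c"
      using TR3_morphism[OF TR1_Ident[OF o(1) N] t Ident_in_Hom[OF o(1)] arrD(3)[OF a(1)]] by simp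
    then obtain c where c: "c \<in> Hom D N Z" "c \<cdot> ZeroHom D X N = g \<cdot> f" by blast
    then show ?thesis using Comp_Zero_right[of N Z c X] o zero_objectD(1)[OF N] by (simp add: arr_def)
  qed
  show "g \<cdot> f = ZeroHom D X Z" "h \<cdot> g = ZeroHom D Y (shO 1 X)"
    using *[OF t] *[OF rotate[OF t]] by blast+
qed

lemma tri_zero_Ident:
  assumes N: "zero_object D N" and X: "X \<in> Obj D"
  shows "tri N X X (ZeroHom D N X) (Ident D X) (ZeroHom D X (shO 1 N))"
proof -
  \<comment> \<open>The zero object is shifted so that rotating back restores N itself.\<close>
  have t: "tri X X (shO 1 N) (Ident D X) (ZeroHom D X (shO 1 N)) (ZeroHom D (shO 1 N) (shO 1 X))"
    using TR1_Ident X shift_zero_object[OF N] by blast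
  note r = rotate_back[OF t]
  show ?thesis using r tri_arr(1)[OF r] zero_objectD(1,3)[OF N] by simp
qed

text \<open>
  Exactness of \<open>Hom(-, T)\<close> at \<open>Y\<close>: complete \<open>(0, u)\<close> to a morphism of triangles into
  \<open>0 \<rightarrow> T \<rightarrow> T \<rightarrow> 0[1]\<close>.
\<close>

lemma tri_extend:
  assumes t: "tri X Y Z f g h" and u: "arr Y T u" "u \<cdot> f = ZeroHom D X T"
  shows "\<exists>v. arr Z T v \<and> v \<cdot> g = u"
proof -
  note a = tri_arr[OF t] and o = tri_Obj[OF t]
  have T: "T \<in> Obj D" using u arrD by blast
  obtain N where N: "zero_object D N" using ex_zero_object by blast
  have "u \<cdot> f = ZeroHom D N T \<cdot> ZeroHom D X N"
    using u(2) Comp_Zero_right arr_Zero zero_objectD(1)[OF N] T o by metis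
  then have "\<exists>c\<in>Hom D Z T. c \<cdot> g = Ident D T \<cdot> u \<and> shH 1 (ZeroHom D X N) \<cdot> h = ZeroHom D T (shO 1 N) \<cdot> c"
    using TR3_morphism[OF t tri_zero_Ident[OF N T]] arr_Zero[OF o(1) zero_objectD(1)[OF N]] arrD(3) u by blast
  then show ?thesis using arr_Ident_left[OF u(1)] o T by (auto simp: arr_def)
qed

text \<open>
  Exactness of \<open>Hom(T, -)\<close> at \<open>Y\<close>. A morphism of triangles can be completed at the third
  corner, whereas here the first corner is wanted, so both \<open>T \<rightarrow> T \<rightarrow> 0\<close> and the given triangle are
  rotated once and the completed morphism is shifted back.
\<close>

lemma tri_lift:
  assumes t: "tri X Y Z f g h" and u: "arr T Y u" "g \<cdot> u = ZeroHom D T Z"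
  shows "\<exists>v. arr T X v \<and> f \<cdot> v = u"
proof -
  note a = tri_arr[OF t] and o = tri_Obj[OF t]
  have T: "T \<in> Obj D" using u arrD by blast
  obtain N where N: "zero_object D N" using ex_zero_object by blast
  have "ZeroHom D N Z \<cdot> ZeroHom D T N = g \<cdot> u"
    using u(2) Comp_Zero_right arr_Zero zero_objectD(1)[OF N] T o by metis
  then have "\<exists>c\<in>Hom D (shO 1 T) (shO 1 X). c \<cdot> ZeroHom D N (shO 1 T) = h \<cdot> ZeroHom D N Z \<and>
      shH 1 u \<cdot> neg_hom D (shO 1 T) (shO 1 T) (shH 1 (Ident D T))
      = neg_hom D (shO 1 X) (shO 1 Y) (shH 1 f) \<cdot> c"
    using TR3_morphism[OF rotate[OF TR1_Ident[OF T N]] rotate[OF t] arrD(3)[OF u(1)]]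
      arr_Zero[OF zero_objectD(1)[OF N] o(3)] arrD(3) by blast
  then obtain c where c: "arr (shO 1 T) (shO 1 X) c"
    and eq: "shH 1 u \<cdot> neg_hom D (shO 1 T) (shO 1 T) (shH 1 (Ident D T))
      = neg_hom D (shO 1 X) (shO 1 Y) (shH 1 f) \<cdot> c"
    using T o ShiftObj_in by (auto simp: arr_def)
  note u1 = arr_shift[OF u(1), of 1] and f1 = arr_shift[OF a(1), of 1]
  have "neg_hom D (shO 1 T) (shO 1 Y) (shH 1 u) = neg_hom D (shO 1 T) (shO 1 Y) (shH 1 f \<cdot> c)"
    using eq Comp_neg_right[OF arr_Ident u1] Comp_neg_left[OF c f1] arr_Ident_right[OF u1]
      ShiftHom_Ident[OF T] ShiftObj_in[OF T] by simp
  then have "shH 1 u = shH 1 f \<cdot> c" using neg_neg[OF u1] neg_neg[OF arr_Comp[OF c f1]] by metis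
  then have "shH (-1) (shH 1 u) = shH (-1) (shH 1 f) \<cdot> shH (-1) c" using shift_Comp[OF c f1] by simp
  then have "u = f \<cdot> shH (-1) c" using shift_Hom_inverse u(1) a(1) by simp
  moreover have "arr T X (shH (-1) c)" using arr_shift[OF c, of "-1"] T o by simp
  ultimately show ?thesis by blast
qed

text \<open>
  The first map of a triangle cancels against sources with no morphism to \<open>Z[-1]\<close>: the kernel of
  composition with \<open>f\<close> is the image of \<open>Hom(T, Z[-1])\<close>.
\<close>

lemma tri_left_cancel:
  assumes t: "tri X Y Z f g h" and u: "arr T X u" "arr T X v" "f \<cdot> u = f \<cdot> v"
    and zero: "Hom D T (shO (-1) Z) = {ZeroHom D T (shO (-1) Z)}"
  shows "u = v"
proof (rule left_cancel_if_zero[OF tri_arr(1)[OF t] u])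
  fix w assume w: "arr T X w" "f \<cdot> w = ZeroHom D T Y"
  note r = rotate_back[OF t]
  obtain w' where w': "arr T (shO (-1) Z) w'" "neg_hom D (shO (-1) Z) X (shH (-1) h) \<cdot> w' = w"
    using tri_lift[OF r w] by blast
  then have "w' = ZeroHom D T (shO (-1) Z)" using zero arrD(3) by blast
  then show "w = ZeroHom D T X" using w' Comp_Zero_right[OF tri_arr(1)[OF r]] arrD(1)[OF w(1)] by metis
qed

lemma tri_right_cancel:
  assumes t: "tri X Y Z f g h" and u: "arr Z T u" "arr Z T v" "u \<cdot> g = v \<cdot> g"
    and zero: "Hom D (shO 1 X) T = {ZeroHom D (shO 1 X) T}"
  shows "u = v"
proof (rule right_cancel_if_zero[OF tri_arr(2)[OF t] u])
  fix w assume w: "arr Z T w" "w \<cdot> g = ZeroHom D Y T"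
  obtain w' where w': "arr (shO 1 X) T w'" "w' \<cdot> h = w"
    using tri_extend[OF rotate[OF t] w] by blast
  then have "w' = ZeroHom D (shO 1 X) T" using zero arrD(3) by blast
  then show "w = ZeroHom D Z T" using w' Comp_Zero_left[OF tri_arr(3)[OF t]] arrD(2)[OF w(1)] by metis
qed

lemma tri_is_iso_first:
  assumes t: "tri X Y Z f g h" and Z: "zero_object D Z"
  shows "is_iso D X Y f"
proof -
  note a = tri_arr[OF t] and o = tri_Obj[OF t]
  note i = arr_Ident[OF o(1)] arr_Ident[OF o(2)]
  note r = rotate_back[OF t]
  have "g \<cdot> Ident D Y = ZeroHom D Y Z" using zero_objectD(2)[OF Z] arr_Comp[OF i(2) a(2)] by blast
  then obtain v where v: "arr Y X v" "f \<cdot> v = Ident D Y" using tri_lift[OF t i(2)] by blast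
  have "Ident D X \<cdot> neg_hom D (shO (-1) Z) X (shH (-1) h) = ZeroHom D (shO (-1) Z) X"
    using zero_objectD(3)[OF shift_zero_object[OF Z]] arr_Comp[OF tri_arr(1)[OF r] i(1)] by blast
  then obtain v' where v': "arr Y X v'" "v' \<cdot> f = Ident D X" using tri_extend[OF r i(1)] by blast
  show ?thesis using is_iso_one_sided[OF a(1) v' v] .
qed

lemma tri_is_iso_second:
  assumes t: "tri X Y Z f g h" and X: "zero_object D X"
  shows "is_iso D Y Z g"
  using tri_is_iso_first[OF rotate[OF t] shift_zero_object[OF X]] .

lemma ex_cocone:
  assumes "arr Y Z g" shows "\<exists>X f h. tri X Y Z f g h"
  using TR1_cone[of Y Z g] rotate_back arrD[OF assms] by blast

text \<open>
  The octahedral axiom for the composition of \<open>f\<close> with an identity, whose cone is zero, yields a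
  triangle through both cones with zero first corner, and its commutativity relations make the
  comparison isomorphism compatible with both neighbouring maps.
\<close>

lemma cone_unique:
  assumes t: "tri X Y Z f g h" and t': "tri X Y Z' f g' h'"
  shows "\<exists>\<phi>. is_iso D Z Z' \<phi> \<and> \<phi> \<cdot> g = g' \<and> h' \<cdot> \<phi> = h"
proof -
  note a = tri_arr[OF t] and o = tri_Obj[OF t]
  obtain N where N: "zero_object D N" using ex_zero_object by blast
  have "tri X Y Z (f \<cdot> Ident D X) g h" using t arr_Ident_right[OF a(1)] by simp
  from TR4_octahedral[OF TR1_Ident[OF o(1) N] t' this]
  obtain b e k where "tri N Z Z' k b e" "b \<cdot> g = g'" "h' \<cdot> b = shH 1 (Ident D X) \<cdot> h" by blast
  then show ?thesis
    using tri_is_iso_second[OF _ N] ShiftHom_Ident[OF o(1)] arr_Ident_left[OF a(3)] by metis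
qed

lemma cocone_unique:
  assumes t: "tri X Y Z f g h" and t': "tri X' Y Z f' g h'"
  shows "\<exists>\<phi>. is_iso D X X' \<phi> \<and> f' \<cdot> \<phi> = f"
proof -
  note a = tri_arr[OF t] and o = tri_Obj[OF t]
  note a' = tri_arr[OF t'] and o' = tri_Obj[OF t']
  note f1 = arr_shift[OF a(1), of 1] and f1' = arr_shift[OF a'(1), of 1]
  obtain b where b: "is_iso D (shO 1 X) (shO 1 X') b"
    "neg_hom D (shO 1 X') (shO 1 Y) (shH 1 f') \<cdot> b = neg_hom D (shO 1 X) (shO 1 Y) (shH 1 f)"
    using cone_unique[OF rotate[OF t] rotate[OF t']] by blast
  have ab: "arr (shO 1 X) (shO 1 X') b" using b(1) o o' ShiftObj_in by (simp add: is_iso_def arr_def)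
  have "shH 1 f' \<cdot> b = shH 1 f"
    using b(2) Comp_neg_left[OF ab f1'] neg_neg[OF f1] neg_neg[OF arr_Comp[OF ab f1']] by metis
  then have "shH (-1) (shH 1 f') \<cdot> shH (-1) b = shH (-1) (shH 1 f)" using shift_Comp[OF ab f1'] by metis
  then have "f' \<cdot> shH (-1) b = f" using shift_Hom_inverse a(1) a'(1) by simp
  moreover have "is_iso D X X' (shH (-1) b)"
    using shift_is_iso[OF b(1), of "-1"] o o' ShiftObj_in by simp
  ultimately show ?thesis by blast
qed

lemma tri_iso1:
  assumes t: "tri X Y Z f g h" and i: "is_iso D X' X i" and X': "X' \<in> Obj D"
  shows "\<exists>h'. tri X' Y Z (f \<cdot> i) g h'"
proof -
  note a = tri_arr[OF t] and o = tri_Obj[OF t]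
  obtain j where j: "arr X' X i" "arr X X' j" "i \<cdot> j = Ident D X" "is_iso D X X' j"
    using is_isoE[OF i X' o(1)] by metis
  have "tri X' Y Z (f \<cdot> i) g (shH 1 j \<cdot> h)"
  proof (rule TR1_iso[OF t _ j(4) is_iso_Ident[OF o(2)] is_iso_Ident[OF o(3)]])
    show "is_candidate_triangle D X' Y Z (f \<cdot> i) g (shH 1 j \<cdot> h)"
      using candidateI[OF arr_Comp[OF j(1) a(1)] a(2) arr_Comp[OF a(3) arr_shift[OF j(2)]]] .
    show "Ident D Y \<cdot> f = f \<cdot> i \<cdot> j"
      using arr_assoc[OF j(2,1) a(1)] j(3) a(1) by (simp add: arr_Ident_left arr_Ident_right)
    show "Ident D Z \<cdot> g = g \<cdot> Ident D Y" using a(2) by (simp add: arr_Ident_left arr_Ident_right)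
    show "shH 1 j \<cdot> h = shH 1 j \<cdot> h \<cdot> Ident D Z"
      using arr_Ident_right[OF arr_Comp[OF a(3) arr_shift[OF j(2)]]] by simp
  qed
  then show ?thesis by blast
qed

lemma tri_iso2:
  assumes t: "tri X Y Z f g h" and i: "is_iso D Y Y' i" and Y': "Y' \<in> Obj D"
  shows "\<exists>g'. tri X Y' Z (i \<cdot> f) g' h"
proof -
  note a = tri_arr[OF t] and o = tri_Obj[OF t]
  obtain j where j: "arr Y Y' i" "arr Y' Y j" "j \<cdot> i = Ident D Y"
    using is_isoE[OF i o(2) Y'] by metis
  have "tri X Y' Z (i \<cdot> f) (g \<cdot> j) h"
  proof (rule TR1_iso[OF t _ is_iso_Ident[OF o(1)] i is_iso_Ident[OF o(3)]])
    show "is_candidate_triangle D X Y' Z (i \<cdot> f) (g \<cdot> j) h"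
      using candidateI[OF arr_Comp[OF a(1) j(1)] arr_Comp[OF j(2) a(2)] a(3)] .
    show "i \<cdot> f = i \<cdot> f \<cdot> Ident D X" using arr_Ident_right[OF arr_Comp[OF a(1) j(1)]] by simp
    show "Ident D Z \<cdot> g = g \<cdot> j \<cdot> i"
      using arr_assoc[OF j(1,2) a(2)] j(3) a(2) by (simp add: arr_Ident_left arr_Ident_right)
    show "shH 1 (Ident D X) \<cdot> h = h \<cdot> Ident D Z"
      using a(3) ShiftHom_Ident[OF o(1)] by (simp add: arr_Ident_left arr_Ident_right)
  qed
  then show ?thesis by blast
qed

lemma tri_iso3:
  assumes t: "tri X Y Z f g h" and i: "is_iso D Z Z' i" and Z': "Z' \<in> Obj D"
  shows "\<exists>h'. tri X Y Z' f (i \<cdot> g) h'"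
proof -
  note a = tri_arr[OF t] and o = tri_Obj[OF t]
  obtain j where j: "arr Z Z' i" "arr Z' Z j" "j \<cdot> i = Ident D Z"
    using is_isoE[OF i o(3) Z'] by metis
  have "tri X Y Z' f (i \<cdot> g) (h \<cdot> j)"
  proof (rule TR1_iso[OF t _ is_iso_Ident[OF o(1)] is_iso_Ident[OF o(2)] i])
    show "is_candidate_triangle D X Y Z' f (i \<cdot> g) (h \<cdot> j)"
      using candidateI[OF a(1) arr_Comp[OF a(2) j(1)] arr_Comp[OF j(2) a(3)]] .
    show "Ident D Y \<cdot> f = f \<cdot> Ident D X" using a(1) by (simp add: arr_Ident_left arr_Ident_right)
    show "i \<cdot> g = i \<cdot> g \<cdot> Ident D Y" using arr_Ident_right[OF arr_Comp[OF a(2) j(1)]] by simp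
    show "shH 1 (Ident D X) \<cdot> h = h \<cdot> j \<cdot> i"
      using arr_assoc[OF j(1,2) a(3)] j(3) a(3) ShiftHom_Ident[OF o(1)]
      by (simp add: arr_Ident_left arr_Ident_right)
  qed
  then show ?thesis by blast
qed

text \<open>
  With \<open>Q\<close> the cone of the inclusion \<open>i\<close>, the projection \<open>q\<close> factors through a morphism \<open>v : Q \<rightarrow> Y\<close>.
  Since \<open>i\<close> is a split monomorphism, the connecting map of the triangle vanishes, so that
  \<open>B \<rightarrow> Q\<close> is an epimorphism; this makes \<open>v\<close> invertible.
\<close>

lemma tri_biproduct:
  assumes b: "is_biproduct D X Y B i j p q" and X: "X \<in> Obj D" and Y: "Y \<in> Obj D"
  shows "\<exists>h. tri X B Y i q h"
proof -
  have B: "B \<in> Obj D" using b by (simp add: is_biproduct_def)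
  have i: "arr X B i" and j: "arr Y B j" and p: "arr B X p" and q: "arr B Y q"
    using b X Y by (simp_all add: is_biproduct_def arr_def)
  have eq: "p \<cdot> i = Ident D X" "q \<cdot> j = Ident D Y" "q \<cdot> i = ZeroHom D X Y"
    "(i \<cdot> p) \<boxplus> (j \<cdot> q) = Ident D B" using b by (simp_all add: is_biproduct_def)
  obtain Q c h where t: "tri X B Q i c h" using TR1_cone[OF X B] arrD(3)[OF i] by blast
  note c = tri_arr(2)[OF t] and Q = tri_Obj(3)[OF t]
  obtain v where v: "arr Q Y v" "v \<cdot> c = q" using tri_extend[OF t q eq(3)] by blast
  note cj = arr_Comp[OF j c]
  have vcj: "v \<cdot> (c \<cdot> j) = Ident D Y" using arr_assoc[OF j c v(1)] v eq by simp
  have "c \<cdot> j \<cdot> v \<cdot> c = Ident D Q \<cdot> c"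
  proof -
    have "c = (c \<cdot> (i \<cdot> p)) \<boxplus> (c \<cdot> (j \<cdot> q))"
      using arr_distrib_left[OF arr_Comp[OF p i] arr_Comp[OF q j] c] eq(4) arr_Ident_right[OF c] by simp
    also have "c \<cdot> (i \<cdot> p) = ZeroHom D B Q"
      using arr_assoc[OF p i c] tri_Comp_Zero(1)[OF t] Comp_Zero_left[OF p Q] by simp
    also have "ZeroHom D B Q \<boxplus> (c \<cdot> (j \<cdot> q)) = c \<cdot> (j \<cdot> q)"
      using add_zero_left[OF arr_Comp[OF arr_Comp[OF q j] c]] .
    finally have "c = c \<cdot> (j \<cdot> q)" .
    then show ?thesis
      using arr_assoc[OF q j c] arr_assoc[OF c v(1) cj] v arr_Ident_left[OF c] by simp
  qed
  moreover have "w = ZeroHom D Q T" if w: "arr Q T w" "w \<cdot> c = ZeroHom D B T" for T w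
  proof -
    obtain w' where w': "arr (shO 1 X) T w'" "w' \<cdot> h = w" using tri_extend[OF rotate[OF t] w] by blast
    have "neg_hom D (shO 1 X) (shO 1 B) (shH 1 i) \<cdot> h = ZeroHom D Q (shO 1 B)"
      using tri_Comp_Zero(2)[OF rotate[OF t]] .
    then have "shH 1 i \<cdot> h = ZeroHom D Q (shO 1 B)"
      using Comp_neg_left[OF tri_arr(3)[OF t] arr_shift[OF i]] neg_neg[OF arr_Comp[OF tri_arr(3)[OF t] arr_shift[OF i]]]
        neg_unique[OF arr_Zero arr_Zero add_zero_right[OF arr_Zero]] Q B ShiftObj_in by metis
    then have "shH 1 p \<cdot> (shH 1 i \<cdot> h) = ZeroHom D Q (shO 1 X)"
      using Comp_Zero_right[OF arr_shift[OF p] Q] by simp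
    moreover have "shH 1 p \<cdot> (shH 1 i \<cdot> h) = h"
      using arr_assoc[OF tri_arr(3)[OF t] arr_shift[OF i] arr_shift[OF p]] shift_Comp[OF i p, of 1] eq(1)
        ShiftHom_Ident[OF X] arr_Ident_left[OF tri_arr(3)[OF t]] by simp
    ultimately show ?thesis using w' Comp_Zero_right[OF w'(1) Q] by simp
  qed
  ultimately have "c \<cdot> j \<cdot> v = Ident D Q"
    using right_cancel_if_zero[OF c arr_Comp[OF v(1) cj] arr_Ident[OF Q]] by blast
  then have "is_iso D Q Y v" using is_isoI[OF v(1) cj] vcj by blast
  then show ?thesis using tri_iso3[OF t _ Y] v(2) by blast
qed

abbreviation orth :: "'o \<Rightarrow> 'o \<Rightarrow> bool" where
  "orth X Y \<equiv> Hom D X Y = {ZeroHom D X Y}"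

lemma orthI:
  assumes "X \<in> Obj D" "Y \<in> Obj D" "\<And>f. arr X Y f \<Longrightarrow> f = ZeroHom D X Y" shows "orth X Y"
  using assms arr_Zero[OF assms(1,2)] unfolding arr_def by blast

lemma orthD: "\<lbrakk>orth X Y; arr X Y f\<rbrakk> \<Longrightarrow> f = ZeroHom D X Y"
  by (auto simp: arr_def)

lemma orth_zero_object:
  assumes "zero_object D N" "T \<in> Obj D" shows "orth N T" "orth T N"
  using orthI zero_objectD assms by metis+

lemma orth_extension_left:
  assumes t: "tri A X B f g h" and A: "orth A T" and B: "orth B T" and T: "T \<in> Obj D"
  shows "orth X T"
proof (rule orthI[OF tri_Obj(2)[OF t] T])
  fix u assume u: "arr X T u"
  have "u \<cdot> f = ZeroHom D A T" using orthD[OF A arr_Comp[OF tri_arr(1)[OF t] u]] .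
  then obtain v where v: "arr B T v" "v \<cdot> g = u" using tri_extend[OF t u] by blast
  then show "u = ZeroHom D X T" using orthD[OF B v(1)] Comp_Zero_left[OF tri_arr(2)[OF t] T] by simp
qed

lemma orth_extension_right:
  assumes t: "tri A X B f g h" and A: "orth T A" and B: "orth T B" and T: "T \<in> Obj D"
  shows "orth T X"
proof (rule orthI[OF T tri_Obj(2)[OF t]])
  fix u assume u: "arr T X u"
  have "g \<cdot> u = ZeroHom D T B" using orthD[OF B arr_Comp[OF u tri_arr(2)[OF t]]] .
  then obtain v where v: "arr T A v" "f \<cdot> v = u" using tri_lift[OF t u] by blast
  then show "u = ZeroHom D T X" using orthD[OF A v(1)] Comp_Zero_right[OF tri_arr(1)[OF t] T] by simp
qed

lemma orth_shift:
  assumes "orth X Y" and o: "X \<in> Obj D" "Y \<in> Obj D" shows "orth (shO n X) (shO n Y)"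
proof (rule orthI)
  show "shO n X \<in> Obj D" "shO n Y \<in> Obj D" using o ShiftObj_in by blast+
  fix f assume f: "arr (shO n X) (shO n Y) f"
  have "arr X Y (shH (-n) f)" using arr_shift[OF f, of "-n"] shift_Obj_inverse o by simp
  then have "shH (-n) f = ZeroHom D X Y" using assms orthD by blast
  then show "f = ZeroHom D (shO n X) (shO n Y)"
    using shift_Hom_inverse[OF f, of n "-n"] shift_Zero o by simp
qed

lemma orth_shift_right_iff:
  assumes o: "X \<in> Obj D" "Y \<in> Obj D" shows "orth X (shO n Y) \<longleftrightarrow> orth (shO (-n) X) Y"
  using orth_shift[of X "shO n Y" "-n"] orth_shift[of "shO (-n) X" Y n] o
  by (auto simp: ShiftObj_in shift_Obj_inverse)

end


section \<open>Extension-closed subcategories without negative morphisms\<close>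

text \<open>
  By a theorem of Dyer, an extension-closed subcategory without negative morphisms inherits an exact
  structure from the triangles, whence the name.
\<close>

locale exact_subcategory = triangulated_category D
  for D :: "('o, 'm, 'x) triangulated_category_scheme" (structure) +
  fixes W :: "'o set"
  assumes strict: "strict_subcategory D W"
    and closed: "extension_closed D W"
    and no_neg: "no_negative_homs D W"
begin

abbreviation E where "E \<equiv> full_subcategory D W"

lemma W_Obj: "X \<in> W \<Longrightarrow> X \<in> Obj D"
  using strict by (auto simp: strict_subcategory_def)

lemma W_extension: "\<lbrakk>tri A X B f g h; A \<in> W; B \<in> W\<rbrakk> \<Longrightarrow> X \<in> W"
  using closed unfolding extension_closed_def by blast

lemma W_orth: "\<lbrakk>X \<in> W; Y \<in> W\<rbrakk> \<Longrightarrow> orth X (shO (-1) Y)" "\<lbrakk>X \<in> W; Y \<in> W\<rbrakk> \<Longrightarrow> orth (shO 1 X) Y"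
proof -
  assume XY: "X \<in> W" "Y \<in> W"
  show "orth X (shO (-1) Y)" using no_neg XY unfolding no_negative_homs_def by auto
  then show "orth (shO 1 X) Y" using orth_shift_right_iff[of X Y "-1"] XY W_Obj by simp
qed

sublocale E: preadditive_category E
  using preadditive_full_subcategory W_Obj by blast

lemma E_arr: "E.arr X Y f \<longleftrightarrow> X \<in> W \<and> Y \<in> W \<and> arr X Y f"
  using W_Obj by (auto simp: E.arr_def arr_def)

text \<open>
  The vanishing of negative morphisms enters the abelian structure through this lemma and its dual: as
  seen from \<open>W\<close>, the first map of a triangle in \<open>W\<close> is monic and the second is epic.
\<close>

lemma tri_monic:
  assumes "tri X Y Z f g h" "T \<in> W" "Z \<in> W" "arr T X u" "arr T X v" "f \<cdot> u = f \<cdot> v"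
  shows "u = v"
  using tri_left_cancel assms W_orth by blast

lemma tri_epic:
  assumes "tri X Y Z f g h" "T \<in> W" "X \<in> W" "arr Z T u" "arr Z T v" "u \<cdot> g = v \<cdot> g"
  shows "u = v"
  using tri_right_cancel assms W_orth by blast

lemma tri_is_kernel:
  assumes t: "tri X Y Z f g h" and W: "X \<in> W" "Z \<in> W"
  shows "is_kernel E Y Z g X f"
  unfolding is_kernel_def
proof (simp, intro conjI ballI impI)
  note a = tri_arr[OF t] and o = tri_Obj[OF t]
  show "X \<in> W" by fact
  show "f \<in> Hom D X Y" using a arrD by blast
  show "g \<cdot> f = ZeroHom D X Z" using tri_Comp_Zero[OF t] by blast
  fix T u assume T: "T \<in> W" and u: "u \<in> Hom D T Y" "g \<cdot> u = ZeroHom D T Z"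
  then obtain v where v: "arr T X v" "f \<cdot> v = u" using tri_lift[OF t] arrI W_Obj o by metis
  show "\<exists>!v. v \<in> Hom D T X \<and> f \<cdot> v = u"
  proof (rule ex1I[of _ v])
    show "v \<in> Hom D T X \<and> f \<cdot> v = u" using v arrD by blast
    fix v' assume "v' \<in> Hom D T X \<and> f \<cdot> v' = u"
    then show "v' = v" using tri_monic[OF t T W(2)] v arrI arrD by metis
  qed
qed

lemma tri_is_cokernel:
  assumes t: "tri X Y Z f g h" and W: "X \<in> W" "Z \<in> W"
  shows "is_cokernel E X Y f Z g"
  unfolding is_cokernel_def
proof (simp, intro conjI ballI impI)
  note a = tri_arr[OF t] and o = tri_Obj[OF t]
  show "Z \<in> W" by fact
  show "g \<in> Hom D Y Z" using a arrD by blast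
  show "g \<cdot> f = ZeroHom D X Z" using tri_Comp_Zero[OF t] by blast
  fix T u assume T: "T \<in> W" and u: "u \<in> Hom D Y T" "u \<cdot> f = ZeroHom D X T"
  then obtain v where v: "arr Z T v" "v \<cdot> g = u" using tri_extend[OF t] arrI W_Obj o by metis
  show "\<exists>!v. v \<in> Hom D Z T \<and> v \<cdot> g = u"
  proof (rule ex1I[of _ v])
    show "v \<in> Hom D Z T \<and> v \<cdot> g = u" using v arrD by blast
    fix v' assume "v' \<in> Hom D Z T \<and> v' \<cdot> g = u"
    then show "v' = v" using tri_epic[OF t T W(1)] v arrI arrD by metis
  qed
qed

lemma tri_short_exact:
  assumes "tri X Y Z f g h" "X \<in> W" "Z \<in> W"
  shows "short_exact E X Y Z f g"
  using assms tri_is_kernel tri_is_cokernel by (simp add: short_exact_def)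

lemma tri_is_mono:
  assumes t: "tri X Y Z f g h" and W: "X \<in> W" "Y \<in> W" "Z \<in> W"
  shows "is_mono E X Y f"
  using E.is_kernel_is_mono[OF tri_is_kernel[OF t W(1,3)]] W arrD(3)[OF tri_arr(2)[OF t]] by simp

lemma ex_zero_W: "\<exists>N\<in>W. zero_object D N"
  using strict by (simp add: strict_subcategory_def)

lemma zero_object_E: "zero_object E N \<longleftrightarrow> N \<in> W \<and> zero_object D N"
  using zero_object_full_subcategory W_Obj by blast

lemma additive_E: "additive_category E"
proof
  show "\<exists>N. zero_object E N" using ex_zero_W zero_object_E by blast
  fix X Y assume XY: "X \<in> Obj E" "Y \<in> Obj E"
  then obtain B i j p q where b: "is_biproduct D X Y B i j p q" using ex_biproduct[of X Y] W_Obj by auto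
  then have "B \<in> W" using tri_biproduct[OF b W_Obj W_Obj] W_extension XY by auto
  then have "is_biproduct E X Y B i j p q" using b by (simp add: is_biproduct_def)
  then show "\<exists>B i j p q. is_biproduct E X Y B i j p q" by blast
qed

text \<open>
  A conflation \<open>K \<rightarrow> X \<rightarrow> I\<close> followed by a conflation \<open>I \<rightarrow> Y \<rightarrow> Q\<close>, so that \<open>K\<close>, \<open>I\<close> and \<open>Q\<close> will
  be kernel, image and cokernel of \<open>f\<close>.
\<close>

definition admissible :: "'o \<Rightarrow> 'o \<Rightarrow> 'm \<Rightarrow> bool" where
  "admissible X Y f \<longleftrightarrow> (\<exists>K I Q k p u i q v. K \<in> W \<and> I \<in> W \<and> Q \<in> W \<and>
     tri K X I k p u \<and> tri I Y Q i q v \<and> f = i \<cdot> p)"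

lemma zero_object_if_monic_zero:
  assumes t: "tri K X I k p u" and W: "K \<in> W" "I \<in> W" and k: "k = ZeroHom D K X"
  shows "zero_object D K"
proof -
  note o = tri_Obj[OF t]
  have "k \<cdot> Ident D K = k \<cdot> ZeroHom D K K"
    using k arr_Ident_right[OF tri_arr(1)[OF t]] Comp_Zero_right[OF tri_arr(1)[OF t] o(1)] by simp
  then show ?thesis
    using tri_monic[OF t W arr_Ident[OF o(1)] arr_Zero[OF o(1) o(1)]] zero_object_iff o(1) by blast
qed

lemma zero_object_if_epic_zero:
  assumes t: "tri I Y Q i q v" and W: "I \<in> W" "Q \<in> W" and q: "q = ZeroHom D Y Q"
  shows "zero_object D Q"
proof -
  note o = tri_Obj[OF t]
  have "Ident D Q \<cdot> q = ZeroHom D Q Q \<cdot> q"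
    using q arr_Ident_left[OF tri_arr(2)[OF t]] Comp_Zero_left[OF tri_arr(2)[OF t] o(3)] by simp
  then show ?thesis
    using tri_epic[OF t W(2,1) arr_Ident[OF o(3)] arr_Zero[OF o(3) o(3)]] zero_object_iff o(3) by blast
qed

lemma admissible_has_kernel:
  assumes a: "admissible X Y f" and X: "X \<in> W" and Y: "Y \<in> W"
  shows "\<exists>K k. is_kernel E X Y f K k"
proof -
  obtain K I Q k p u i q v where W: "K \<in> W" "I \<in> W" "Q \<in> W"
    and t: "tri K X I k p u" and t': "tri I Y Q i q v" and f: "f = i \<cdot> p"
    using a unfolding admissible_def by blast
  note a = tri_arr[OF t] and a' = tri_arr[OF t'] and o = tri_Obj[OF t] and o' = tri_Obj[OF t']
  have ker: "is_kernel E X I p K k" using tri_is_kernel[OF t W(1,2)] .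
  have "p \<cdot> w = ZeroHom D T I" if T: "T \<in> W" and w: "w \<in> Hom D T X" "f \<cdot> w = ZeroHom D T Y" for T w
  proof -
    have aw: "arr T X w" using w T W_Obj o by (simp add: arr_def)
    have "i \<cdot> (p \<cdot> w) = i \<cdot> ZeroHom D T I"
      using arr_assoc[OF aw a(2) a'(1)] w f Comp_Zero_right[OF a'(1) W_Obj[OF T]] by simp
    then show ?thesis
      using tri_monic[OF t' T W(3) arr_Comp[OF aw a(2)] arr_Zero] o' W_Obj[OF T] by blast
  qed
  moreover have "f \<cdot> k = ZeroHom D K Y"
    using f arr_assoc[OF a(1,2) a'(1)] tri_Comp_Zero(1)[OF t] Comp_Zero_right[OF a'(1) o(1)] by simp
  ultimately have "is_kernel E X Y f K k" using ker by (simp add: is_kernel_def)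
  then show ?thesis by blast
qed

lemma admissible_has_cokernel:
  assumes a: "admissible X Y f" and X: "X \<in> W" and Y: "Y \<in> W"
  shows "\<exists>Q q. is_cokernel E X Y f Q q"
proof -
  obtain K I Q k p u i q v where W: "K \<in> W" "I \<in> W" "Q \<in> W"
    and t: "tri K X I k p u" and t': "tri I Y Q i q v" and f: "f = i \<cdot> p"
    using a unfolding admissible_def by blast
  note a = tri_arr[OF t] and a' = tri_arr[OF t'] and o = tri_Obj[OF t] and o' = tri_Obj[OF t']
  have coker: "is_cokernel E I Y i Q q" using tri_is_cokernel[OF t' W(2,3)] .
  have "w \<cdot> i = ZeroHom D I T" if T: "T \<in> W" and w: "w \<in> Hom D Y T" "w \<cdot> f = ZeroHom D X T" for T w
  proof -
    have aw: "arr Y T w" using w T W_Obj o' by (simp add: arr_def)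
    have "w \<cdot> i \<cdot> p = ZeroHom D I T \<cdot> p"
      using arr_assoc[OF a(2) a'(1) aw] w f Comp_Zero_left[OF a(2) W_Obj[OF T]] by simp
    then show ?thesis
      using tri_epic[OF t T W(1) arr_Comp[OF a'(1) aw] arr_Zero] o' W_Obj[OF T] by blast
  qed
  moreover have "q \<cdot> f = ZeroHom D X Q"
    using f arr_assoc[OF a(2) a'(1,2)] tri_Comp_Zero(1)[OF t'] Comp_Zero_left[OF a(2) o'(3)] by simp
  ultimately have "is_cokernel E X Y f Q q" using coker by (simp add: is_cokernel_def)
  then show ?thesis by blast
qed

text \<open>
  The kernel part of the factorization of a monomorphism is zero, so the morphism agrees with its image
  part up to isomorphism and inherits the triangle of the latter.
\<close>

lemma admissible_mono_tri:
  assumes a: "admissible X Y f" and X: "X \<in> W" and m: "is_mono E X Y f"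
  shows "\<exists>Q q v. Q \<in> W \<and> tri X Y Q f q v"
proof -
  obtain K I Q k p u i q v where W: "K \<in> W" "I \<in> W" "Q \<in> W"
    and t: "tri K X I k p u" and t': "tri I Y Q i q v" and f: "f = i \<cdot> p"
    using a unfolding admissible_def by blast
  note a = tri_arr[OF t] and a' = tri_arr[OF t'] and o = tri_Obj[OF t] and o' = tri_Obj[OF t']
  have "f \<cdot> k = f \<cdot> ZeroHom D K X"
    using f arr_assoc[OF a(1,2) a'(1)] tri_Comp_Zero(1)[OF t] Comp_Zero_right[OF a'(1) o(1)]
      Comp_Zero_right[OF arr_Comp[OF a(2) a'(1)] o(1)] by simp
  then have "k = ZeroHom D K X"
    using m W(1) arrD(3)[OF a(1)] arrD(3)[OF arr_Zero[OF o(1,2)]] unfolding is_mono_def by simp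
  then have "is_iso D X I p"
    using tri_is_iso_second[OF t] zero_object_if_monic_zero[OF t W(1,2)] by blast
  then show ?thesis using tri_iso1[OF t' _ o(2)] f W by blast
qed

lemma admissible_epi_tri:
  assumes a: "admissible X Y f" and Y: "Y \<in> W" and m: "is_epi E X Y f"
  shows "\<exists>K k v. K \<in> W \<and> tri K X Y k f v"
proof -
  obtain K I Q k p u i q v where W: "K \<in> W" "I \<in> W" "Q \<in> W"
    and t: "tri K X I k p u" and t': "tri I Y Q i q v" and f: "f = i \<cdot> p"
    using a unfolding admissible_def by blast
  note a = tri_arr[OF t] and a' = tri_arr[OF t'] and o = tri_Obj[OF t] and o' = tri_Obj[OF t']
  have "q \<cdot> f = ZeroHom D Y Q \<cdot> f"
    using f arr_assoc[OF a(2) a'(1,2)] tri_Comp_Zero(1)[OF t'] Comp_Zero_left[OF a(2) o'(3)]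
      Comp_Zero_left[OF arr_Comp[OF a(2) a'(1)] o'(3)] by simp
  then have "q = ZeroHom D Y Q"
    using m W(3) arrD(3)[OF a'(2)] arrD(3)[OF arr_Zero[OF o'(2,3)]] unfolding is_epi_def by simp
  then have "is_iso D I Y i"
    using tri_is_iso_first[OF t'] zero_object_if_epic_zero[OF t' W(2,3)] by blast
  then show ?thesis using tri_iso3[OF t _ o'(2)] f W by blast
qed

lemma abelian_E:
  assumes adm: "\<And>X Y f. \<lbrakk>X \<in> W; Y \<in> W; f \<in> Hom D X Y\<rbrakk> \<Longrightarrow> admissible X Y f"
  shows "abelian_category E"
proof -
  interpret E: additive_category E using additive_E .
  show ?thesis
  proof
    fix X Y f assume XY: "X \<in> Obj E" "Y \<in> Obj E" 
    { assume "f \<in> Hom E X Y"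
      then have "admissible X Y f" using adm XY by simp
      then show "\<exists>K k. is_kernel E X Y f K k" "\<exists>Q q. is_cokernel E X Y f Q q"
        using admissible_has_kernel admissible_has_cokernel XY by simp_all }
    { assume m: "is_mono E X Y f"
      then have "admissible X Y f" using adm XY by (simp add: is_mono_def)
      then obtain Q q v where q: "Q \<in> W" "tri X Y Q f q v" using admissible_mono_tri[of X Y f] m XY by auto
      then show "\<exists>Z\<in>Obj E. \<exists>g\<in>Hom E Y Z. is_kernel E Y Z g X f"
        using tri_is_kernel[OF q(2)] arrD(3)[OF tri_arr(2)[OF q(2)]] XY by auto }
    { assume m: "is_epi E X Y f"
      then have "admissible X Y f" using adm XY by (simp add: is_epi_def)
      then obtain K k v where k: "K \<in> W" "tri K X Y k f v" using admissible_epi_tri[of X Y f] m XY by auto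
      then show "\<exists>Z\<in>Obj E. \<exists>g\<in>Hom E Z X. is_cokernel E Z X g Y f"
        using tri_is_cokernel[OF k(2)] arrD(3)[OF tri_arr(1)[OF k(2)]] XY by auto }
  qed
qed

text \<open>
  For the direction from exactness to triangles: \<open>f\<close> is a monomorphism and hence begins a triangle in
  \<open>W\<close>, whose third corner is a cokernel of \<open>f\<close> and can be exchanged for \<open>Z\<close>.
\<close>

lemma short_exact_iff_tri:
  assumes adm: "admissible X Y f" and W: "X \<in> W" "Y \<in> W" "Z \<in> W" and g: "g \<in> Hom D Y Z"
  shows "short_exact E X Y Z f g \<longleftrightarrow> (\<exists>h. tri X Y Z f g h)"
proof
  assume "\<exists>h. tri X Y Z f g h"
  then show "short_exact E X Y Z f g" using tri_short_exact W by blast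
next
  assume s: "short_exact E X Y Z f g"
  then have "is_mono E X Y f" using E.is_kernel_is_mono[of Y Z g X f] W g by (simp add: short_exact_def)
  then obtain Q q v where q: "Q \<in> W" "tri X Y Q f q v" using admissible_mono_tri adm W by blast
  then obtain \<phi> where "is_iso E Q Z \<phi>" "Comp E \<phi> q = g"
    using E.cokernel_unique[OF tri_is_cokernel[OF q(2) W(1) q(1)], of Z g] s W
    unfolding short_exact_def by auto
  then show "\<exists>h. tri X Y Z f g h" using tri_iso3[OF q(2) _ W_Obj[OF W(3)]] by auto
qed

end


section \<open>Iterated extensions\<close>

context triangulated_category
begin

text \<open>
  The extension step adds a generator at the bottom of the filtration. With this choice the octahedral
  axiom applies without any shift in the proof of closure under extensions.
\<close>

inductive_set filt :: "'o set \<Rightarrow> 'o set" for S :: "'o set" where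
  zero: "zero_object D N \<Longrightarrow> N \<in> filt S"
| extend: "\<lbrakk>A \<in> S; X' \<in> filt S; tri A X X' s \<pi> \<sigma>\<rbrakk> \<Longrightarrow> X \<in> filt S"

lemma filt_Obj: "X \<in> filt S \<Longrightarrow> X \<in> Obj D"
  by (induction rule: filt.induct) (auto dest: tri_Obj zero_objectD(1))

lemma filt_iso:
  assumes "X \<in> filt S" "is_iso D X Y i" "Y \<in> Obj D" shows "Y \<in> filt S"
  using assms(1)
proof cases
  case zero
  then show ?thesis using zero_object_isomorphic assms filt.zero unfolding isomorphic_def by blast
next
  case (extend A X' s \<pi> \<sigma>)
  then show ?thesis using tri_iso2[OF extend(3) assms(2,3)] filt.extend by blast
qed

lemma filt_generator: "\<lbrakk>A \<in> S; A \<in> Obj D\<rbrakk> \<Longrightarrow> A \<in> filt S"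
  using ex_zero_object TR1_Ident filt.zero filt.extend by metis

text \<open>
  Induction on the filtration of the subobject \<open>A\<close>: with \<open>A0\<close> its bottom layer and \<open>A'\<close> the rest,
  the cone of \<open>A0 \<rightarrow> A \<rightarrow> Z\<close> is an extension of \<open>B\<close> by \<open>A'\<close>.
\<close>

lemma filt_extension:
  assumes "A \<in> filt S" "tri A Z B f g h" "B \<in> filt S"
  shows "Z \<in> filt S"
  using assms
proof (induction arbitrary: Z f g h rule: filt.induct)
  case (zero N)
  then show ?case
    using tri_is_iso_second[OF zero(2,1)] is_isoE[of Z B g] tri_Obj[OF zero(2)] filt_iso by metis
next
  case (extend A0 A' A s \<pi> \<sigma>)
  note t = \<open>tri A0 A A' s \<pi> \<sigma>\<close> and t' = \<open>tri A Z B f g h\<close>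
  note c = arr_Comp[OF tri_arr(1)[OF t] tri_arr(1)[OF t']]
  obtain Q q v where q: "tri A0 Z Q (f \<cdot> s) q v" using TR1_cone arrD[OF c] by blast
  obtain a b e where "tri A' Q B a b e" using TR4_octahedral[OF t t' q] by blast
  then have "Q \<in> filt S" using extend.IH extend.prems(2) by blast
  then show ?case using filt.extend[OF extend(1) _ q] by blast
qed

lemma filt_orth_left:
  assumes "X \<in> filt S" "T \<in> Obj D" "\<And>A. A \<in> S \<Longrightarrow> orth A T" shows "orth X T"
  using assms(1) by (induction rule: filt.induct)
    (use orth_zero_object assms(2) in blast, use orth_extension_left assms(2,3) in blast)

lemma filt_orth_right:
  assumes "X \<in> filt S" "T \<in> Obj D" "\<And>A. A \<in> S \<Longrightarrow> orth T A" shows "orth T X"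
  using assms(1) by (induction rule: filt.induct)
    (use orth_zero_object assms(2) in blast, use orth_extension_right assms(2,3) in blast)

text \<open>
  Vanishing spreads from the generators first along the target and then along the source. For the
  target the shift is moved to the source, so that the triangles themselves are never shifted.
\<close>

lemma filt_no_negative_homs:
  assumes "no_negative_homs D S" "S \<subseteq> Obj D" shows "no_negative_homs D (filt S)"
  unfolding no_negative_homs_def
proof (intro ballI allI impI)
  fix X Y and i :: int assume X: "X \<in> filt S" and Y: "Y \<in> filt S" and i: "i < 0"
  have "orth A (shO i Y)" if A: "A \<in> S" for A
  proof -
    have o: "A \<in> Obj D" using A assms(2) by blast
    have "orth (shO (-i) A) B" if B: "B \<in> S" for B
      using assms A B i o orth_shift_right_iff[of A B i] unfolding no_negative_homs_def by blast
    then have "orth (shO (-i) A) Y" using filt_orth_right Y o ShiftObj_in by blast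
    then show ?thesis using orth_shift_right_iff o filt_Obj[OF Y] by simp
  qed
  then show "orth X (shO i Y)" using filt_orth_left X filt_Obj[OF Y] ShiftObj_in by blast
qed

lemma filt_subset:
  assumes W: "strict_subcategory D W" "extension_closed D W" and S: "S \<subseteq> W"
  shows "filt S \<subseteq> W"
proof
  fix X assume "X \<in> filt S"
  then show "X \<in> W"
  proof (induction rule: filt.induct)
    case (zero N)
    then show ?case
      using W(1) is_iso_zero_objects zero_objectD(1) unfolding strict_subcategory_def isomorphic_def by blast
  next
    case (extend A X' X s \<pi> \<sigma>)
    then show ?case using W(2) S unfolding extension_closed_def by blast
  qed
qed

text \<open>
  Here the extension step adds a generator at the top, as a composition series does.
\<close>

inductive_set cofilt :: "'o set \<Rightarrow> 'o set" for S :: "'o set" where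
  zero: "zero_object D N \<Longrightarrow> N \<in> cofilt S"
| extend: "\<lbrakk>X' \<in> cofilt S; A \<in> S; tri X' X A \<iota> \<pi> \<sigma>\<rbrakk> \<Longrightarrow> X \<in> cofilt S"

text \<open>
  A generator can be inserted below a filtration that grows at the top: peel off the top layer \<open>B\<close> of
  \<open>X'\<close>; the cocone of \<open>X \<rightarrow> X' \<rightarrow> B\<close> is an extension of the remaining object \<open>X''\<close> by \<open>A\<close>.
\<close>

lemma cofilt_extend_bottom:
  assumes S: "\<And>X Y i. \<lbrakk>X \<in> S; is_iso D X Y i; Y \<in> Obj D\<rbrakk> \<Longrightarrow> Y \<in> S"
    and "X' \<in> cofilt S" "A \<in> S" "tri A X X' s \<pi> \<sigma>"
  shows "X \<in> cofilt S"
  using assms(2-)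
proof (induction arbitrary: X s \<pi> \<sigma> rule: cofilt.induct)
  case (zero N)
  then have "X \<in> S" using S tri_is_iso_first tri_Obj by metis
  then show ?case using cofilt.extend[OF cofilt.zero[OF zero(1)]] tri_zero_Ident zero tri_Obj by metis
next
  case (extend X'' B X' \<iota> \<rho> \<tau>)
  note t = \<open>tri A X X' s \<pi> \<sigma>\<close> and t' = \<open>tri X'' X' B \<iota> \<rho> \<tau>\<close>
  note o = tri_Obj[OF t] tri_Obj[OF t']
  note c = arr_Comp[OF tri_arr(2)[OF t] tri_arr(2)[OF t']]
  obtain Q q v where q: "tri X B Q (\<rho> \<cdot> \<pi>) q v" using TR1_cone arrD[OF c] by blast
  obtain a b e where "tri (shO 1 A) Q (shO 1 X'') a b e"
    using TR4_octahedral[OF rotate[OF t] rotate[OF t'] q] by blast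
  then obtain a' b' e' where "tri A (shO (-1) Q) X'' a' b' e'"
    using tri_shift_down o by fastforce
  then have "shO (-1) Q \<in> cofilt S" using extend.IH extend.prems(1) by blast
  then show ?case using cofilt.extend extend(2) rotate_back[OF q] by blast
qed

lemma filt_subset_cofilt:
  assumes "\<And>X Y i. \<lbrakk>X \<in> S; is_iso D X Y i; Y \<in> Obj D\<rbrakk> \<Longrightarrow> Y \<in> S" "X \<in> filt S"
  shows "X \<in> cofilt S"
  using assms(2)
proof (induction rule: filt.induct)
  case (zero N)
  then show ?case using cofilt.zero by blast
next
  case (extend A X' X s \<pi> \<sigma>)
  then show ?case
    by (intro cofilt_extend_bottom[OF _ extend.IH extend.hyps(1,3)]) (blast intro: assms(1))
qed


end


section \<open>Iterated extensions of Hom-orthogonal bricks\<close>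

text \<open>
  The properties of a semibrick without reference to a t-structure. That endomorphism rings are
  division rings and that non-isomorphic members are Hom-orthogonal is combined into Schur's lemma.
\<close>

locale orthogonal_bricks = triangulated_category D
  for D :: "('o, 'm, 'x) triangulated_category_scheme" (structure) +
  fixes S :: "'o set"
  assumes S_subset: "S \<subseteq> Obj D"
    and S_iso: "\<lbrakk>X \<in> S; is_iso D X Y i; Y \<in> Obj D\<rbrakk> \<Longrightarrow> Y \<in> S"
    and S_neg: "no_negative_homs D S"
    and S_nonzero: "X \<in> S \<Longrightarrow> \<not> zero_object D X"
    and S_schur: "\<lbrakk>X \<in> S; Y \<in> S; arr X Y f; f \<noteq> ZeroHom D X Y\<rbrakk> \<Longrightarrow> is_iso D X Y f"
begin

lemma S_Obj: "X \<in> S \<Longrightarrow> X \<in> Obj D" using S_subset by blast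

lemma S_filt: "X \<in> S \<Longrightarrow> X \<in> filt S" using filt_generator S_Obj by blast

sublocale exact_subcategory D "filt S"
proof
  show "strict_subcategory D (filt S)"
    using filt_Obj filt_iso filt.zero ex_zero_object unfolding strict_subcategory_def isomorphic_def by blast
  show "extension_closed D (filt S)" using filt_extension unfolding extension_closed_def by blast
  show "no_negative_homs D (filt S)" using filt_no_negative_homs[OF S_neg S_subset] .
qed

text \<open>
  Induction on the filtration \<open>B \<rightarrow> Y \<rightarrow> Y'\<close> of the target. If \<open>A \<rightarrow> Y \<rightarrow> Y'\<close> is zero, then \<open>f\<close> comes
  from a nonzero, hence invertible, morphism \<open>A \<rightarrow> B\<close>, and its cone is \<open>Y'\<close>. Otherwise the cone of
  \<open>A \<rightarrow> Y'\<close> lies in \<open>filt S\<close> by induction, and the cone of \<open>f\<close> is an extension of it by \<open>B\<close>.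
\<close>

lemma nonzero_from_brick_cone:
  assumes "Y \<in> filt S" "A \<in> S" "arr A Y f" "f \<noteq> ZeroHom D A Y"
  shows "\<exists>C c \<gamma>. C \<in> filt S \<and> tri A Y C f c \<gamma>"
  using assms
proof (induction arbitrary: f rule: filt.induct)
  case (zero N)
  then show ?case using zero_objectD(2) by blast
next
  case (extend B Y' Y s \<pi> \<sigma>)
  note t = \<open>tri B Y Y' s \<pi> \<sigma>\<close> and f = \<open>arr A Y f\<close> and A = \<open>A \<in> S\<close>
  note a = tri_arr[OF t]
  show ?case
  proof (cases "\<pi> \<cdot> f = ZeroHom D A Y'")
    case True
    then obtain u where u: "arr A B u" "s \<cdot> u = f" using tri_lift[OF t f] by blast
    have "u \<noteq> ZeroHom D A B" using u Comp_Zero_right[OF a(1)] S_Obj[OF A] extend.prems(3) by blast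
    then have "is_iso D A B u" using S_schur A extend(1) u(1) by blast
    then show ?thesis using tri_iso1[OF t _ S_Obj[OF A]] u(2) extend(2) by blast
  next
    case False
    note pf = arr_Comp[OF f a(2)]
    obtain C' c' \<gamma>' where C': "C' \<in> filt S" "tri A Y' C' (\<pi> \<cdot> f) c' \<gamma>'"
      using extend.IH[OF A pf False] by blast
    obtain C c \<gamma> where C: "tri A Y C f c \<gamma>" using TR1_cone arrD[OF f] by blast
    obtain x y z where "tri C C' (shO 1 B) x y z" using TR4_octahedral[OF C rotate[OF t] C'(2)] by blast
    then have "C \<in> filt S" using rotate_back[of C C' "shO 1 B" x y z] S_Obj[OF extend(1)] filt.extend[OF extend(1) C'(1)] by auto
    then show ?thesis using C by blast
  qed
qed

lemma admissible_zero_source: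
  assumes N: "zero_object D N" and Y: "Y \<in> filt S" and f: "arr N Y f"
  shows "admissible N Y f"
proof -
  note o = zero_objectD(1)[OF N] filt_Obj[OF Y]
  have "tri N N N (ZeroHom D N N) (Ident D N) (ZeroHom D N (shO 1 N))"
    "tri N Y Y f (Ident D Y) (ZeroHom D Y (shO 1 N))"
    using tri_zero_Ident[OF N] o zero_objectD(3)[OF N f] by blast+
  moreover have "f = f \<cdot> Ident D N" using arr_Ident_right[OF f] by simp
  ultimately show ?thesis unfolding admissible_def using filt.zero[OF N] Y by blast
qed

text \<open>
  The image part is unchanged, and the kernel grows by the generator \<open>A\<close>: the cocone of
  \<open>X \<rightarrow> X' \<rightarrow> I\<close> is an extension of \<open>K\<close> by \<open>A\<close>.
\<close>

lemma admissible_through_quotient: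
  assumes t: "tri A X X' s \<pi> \<sigma>" and A: "A \<in> S" and f: "admissible X' Y f"
  shows "admissible X Y (f \<cdot> \<pi>)"
proof -
  obtain K I Q k p u i q v where W: "K \<in> filt S" "I \<in> filt S" "Q \<in> filt S"
    and t1: "tri K X' I k p u" and t2: "tri I Y Q i q v" and eq: "f = i \<cdot> p"
    using f unfolding admissible_def by blast
  note c = arr_Comp[OF tri_arr(2)[OF t] tri_arr(2)[OF t1]]
  obtain P r w where P: "tri X I P (p \<cdot> \<pi>) r w" using TR1_cone arrD[OF c] by blast
  obtain a b e where "tri (shO 1 A) P (shO 1 K) a b e"
    using TR4_octahedral[OF rotate[OF t] rotate[OF t1] P] by blast
  then obtain a' b' e' where "tri A (shO (-1) P) K a' b' e'"
    using tri_shift_down tri_Obj[OF t] tri_Obj[OF t1] by fastforce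
  then have "shO (-1) P \<in> filt S" using filt.extend A W(1) by blast
  moreover have "f \<cdot> \<pi> = i \<cdot> (p \<cdot> \<pi>)"
    using eq arr_assoc[OF tri_arr(2)[OF t] tri_arr(2)[OF t1] tri_arr(1)[OF t2]] by simp
  ultimately show ?thesis unfolding admissible_def using W(2,3) rotate_back[OF P] t2 by blast
qed

text \<open>
  Here \<open>A\<close> is a common subobject of \<open>X\<close> and \<open>Y\<close> with quotients \<open>X'\<close> and \<open>C\<close>. The kernel \<open>K\<close> and the
  cokernel \<open>Q\<close> of the induced morphism \<open>X' \<rightarrow> C\<close> also serve for \<open>f\<close>, while the image of \<open>f\<close> is the
  preimage in \<open>Y\<close> of the image \<open>I\<close>.
\<close>

lemma admissible_lift_quotient:
  assumes tX: "tri A X X' s \<pi> \<sigma>" and tY: "tri A Y C (f \<cdot> s) c \<gamma>" and A: "A \<in> S"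
    and W: "X' \<in> filt S" "C \<in> filt S" and f: "arr X Y f"
    and f': "admissible X' C f'" and sq: "f' \<cdot> \<pi> = c \<cdot> f"
  shows "admissible X Y f"
proof -
  obtain K I Q k p u i q v where KIQ: "K \<in> filt S" "I \<in> filt S" "Q \<in> filt S"
    and tK: "tri K X' I k p u" and tI: "tri I C Q i q v" and eq: "f' = i \<cdot> p"
    using f' unfolding admissible_def by blast
  note AW = S_filt[OF A]
  note aX = tri_arr[OF tX] and aY = tri_arr[OF tY] and aK = tri_arr[OF tK] and aI = tri_arr[OF tI]
  \<comment> \<open>The image of f: the preimage in Y of the image of f'.\<close>
  obtain J j r where tJ: "tri J Y Q j (q \<cdot> c) r" using ex_cocone[OF arr_Comp[OF aY(2) aI(2)]] by blast
  note aJ = tri_arr[OF tJ]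
  have "q \<cdot> c \<cdot> f = ZeroHom D X Q"
  proof -
    have "q \<cdot> c \<cdot> f = q \<cdot> (i \<cdot> (p \<cdot> \<pi>))"
      using arr_assoc[OF f aY(2) aI(2)] arr_assoc[OF aX(2) aK(2) aI(1)] sq eq by simp
    also have "\<dots> = q \<cdot> i \<cdot> (p \<cdot> \<pi>)" using arr_assoc[OF arr_Comp[OF aX(2) aK(2)] aI(1,2)] by simp
    finally show ?thesis
      using tri_Comp_Zero(1)[OF tI] Comp_Zero_left[OF arr_Comp[OF aX(2) aK(2)] tri_Obj(3)[OF tI]] by simp
  qed
  then obtain t where t: "arr X J t" "j \<cdot> t = f" using tri_lift[OF tJ f] by blast
  note ts = arr_Comp[OF aX(1) t(1)]
  have jts: "j \<cdot> (t \<cdot> s) = f \<cdot> s" using arr_assoc[OF aX(1) t(1) aJ(1)] t(2) by simp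
  \<comment> \<open>M is J divided by A. It is identified below with the image I of f'.\<close>
  obtain M m \<mu> where tM: "tri A J M (t \<cdot> s) m \<mu>" using TR1_cone arrD[OF ts] by blast
  note aM = tri_arr[OF tM]
  have "tri A Y C (j \<cdot> (t \<cdot> s)) c \<gamma>" using tY jts by simp
  from TR4_octahedral[OF tM tJ this] obtain a b e
    where tMC: "tri M C Q a b e" and am: "a \<cdot> m = c \<cdot> j" and bc: "b \<cdot> c = q \<cdot> c" by blast
  have "b = q" using tri_epic[OF tY KIQ(3) AW tri_arr(2)[OF tMC] aI(2) bc] .
  then obtain \<phi> where \<phi>: "is_iso D I M \<phi>" "a \<cdot> \<phi> = i" using cocone_unique[OF tI] tMC by blast
  have aphi: "arr I M \<phi>" using \<phi>(1) tri_Obj(1)[OF tI] tri_Obj(3)[OF tM] by (simp add: is_iso_def arr_def)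
  have MW: "M \<in> filt S" using filt_iso[OF KIQ(2) \<phi>(1) tri_Obj(3)[OF tM]] .
  have JW: "J \<in> filt S" using filt.extend[OF A MW tM] .
  obtain u' where tK': "tri K X' M k (\<phi> \<cdot> p) u'" using tri_iso3[OF tK \<phi>(1) tri_Obj(3)[OF tM]] by blast
  \<comment> \<open>R is K[1] up to isomorphism: the octahedron on A, X, J exhibits it as the cone of X' \<rightarrow> M.\<close>
  obtain R \<rho> \<theta> where tR: "tri X J R t \<rho> \<theta>" using TR1_cone arrD[OF t(1)] by blast
  from TR4_octahedral[OF tX tR tM] obtain a2 b2 e2
    where tX'M: "tri X' M R a2 b2 e2" and a2: "a2 \<cdot> \<pi> = m \<cdot> t" by blast
  \<comment> \<open>Both become f' composed with X \<rightarrow> X' after composing with the epic X \<rightarrow> X' and the monic M \<rightarrow> C.\<close>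
  have "a2 = \<phi> \<cdot> p"
  proof -
    note a2a = tri_arr(1)[OF tX'M] and pp = tri_arr(2)[OF tK'] and aa = tri_arr(1)[OF tMC]
    have "a \<cdot> a2 \<cdot> \<pi> = a \<cdot> m \<cdot> t" using arr_assoc[OF aX(2) a2a aa] arr_assoc[OF t(1) aM(2) aa] a2 by simp
    also have "\<dots> = c \<cdot> f" using am arr_assoc[OF t(1) aJ(1) aY(2)] t(2) by simp
    also have "\<dots> = a \<cdot> (\<phi> \<cdot> p) \<cdot> \<pi>"
      using arr_assoc[OF aK(2) aphi aa] \<phi>(2) eq sq by simp
    finally have "a \<cdot> a2 = a \<cdot> (\<phi> \<cdot> p)"
      using tri_epic[OF tX W(2) AW arr_Comp[OF a2a aa] arr_Comp[OF pp aa]] by blast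
    then show ?thesis using tri_monic[OF tMC W(1) KIQ(3) a2a pp] by blast
  qed
  then obtain \<psi> where "is_iso D K (shO (-1) R) \<psi>"
    using cocone_unique[OF tK'] rotate_back[OF tX'M] by blast
  then have "shO (-1) R \<in> filt S"
    using filt_iso[OF KIQ(1)] tri_Obj(3)[OF tR] ShiftObj_in by blast
  then show ?thesis unfolding admissible_def using JW KIQ(3) rotate_back[OF tR] tJ t(2) by metis
qed

lemma filt_admissible:
  assumes "X \<in> filt S" "Y \<in> filt S" "arr X Y f"
  shows "admissible X Y f"
  using assms
proof (induction arbitrary: Y f rule: filt.induct)
  case (zero N)
  then show ?case using admissible_zero_source by blast
next
  case (extend A X' X s \<pi> \<sigma>)
  note t = \<open>tri A X X' s \<pi> \<sigma>\<close> and f = \<open>arr X Y f\<close> and A = \<open>A \<in> S\<close>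
  show ?case
  proof (cases "f \<cdot> s = ZeroHom D A Y")
    case True
    then obtain f' where "arr X' Y f'" "f' \<cdot> \<pi> = f" using tri_extend[OF t f] by blast
    then show ?thesis using admissible_through_quotient[OF t A] extend.IH extend.prems(1) by blast
  next
    case False
    then obtain C c \<gamma> where C: "C \<in> filt S" "tri A Y C (f \<cdot> s) c \<gamma>"
      using nonzero_from_brick_cone[OF extend.prems(1) A arr_Comp[OF tri_arr(1)[OF t] f]] by blast
    \<comment> \<open>The square of the morphism of triangles that is the identity on A and f on X.\<close>
    have "f \<cdot> s = f \<cdot> s \<cdot> Ident D A" using arr_Ident_right[OF tri_arr(1)[OF C(2)]] by simp
    then obtain f' where f': "f' \<in> Hom D X' C" "f' \<cdot> \<pi> = c \<cdot> f"
      using TR3_morphism[OF t C(2) Ident_in_Hom arrD(3)[OF f]] S_Obj[OF A] by blast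
    have "arr X' C f'" using f'(1) arrI tri_Obj[OF t] tri_Obj[OF C(2)] by blast
    then show ?thesis
      using admissible_lift_quotient[OF t C(2) A extend(2) C(1) f] extend.IH C(1) f'(2) by blast
  qed
qed

text \<open>
  A nonzero subobject \<open>Y\<close> of \<open>A\<close> contains a brick \<open>B\<close>, and the nonzero composite \<open>B \<rightarrow> Y \<rightarrow> A\<close> is
  invertible by Schur's lemma. Thus \<open>Y \<rightarrow> A\<close> is a split epimorphism as well as a monomorphism.
\<close>

lemma simple_object_brick:
  assumes A: "A \<in> S" shows "simple_object E A"
  unfolding simple_object_def
proof (intro conjI ballI allI impI)
  show "A \<in> Obj E" using S_filt[OF A] by simp
  show "\<not> zero_object E A" using S_nonzero[OF A] zero_object_E by blast
  fix Y f assume "Y \<in> Obj E" and m: "is_mono E Y A f"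
  then have Y: "Y \<in> filt S" by simp
  have f: "arr Y A f" using m arrI filt_Obj[OF Y] S_Obj[OF A] by (simp add: is_mono_def)
  from Y show "zero_object E Y \<or> is_iso E Y A f"
  proof cases
    case zero
    then show ?thesis using Y zero_object_E by blast
  next
    case (extend B Y' s \<pi> \<sigma>)
    note t = extend(3) and B = extend(1)
    note s = tri_arr(1)[OF t]
    have "f \<cdot> s \<noteq> ZeroHom D B A"
    proof
      assume "f \<cdot> s = ZeroHom D B A"
      then have "s = ZeroHom D B Y"
        using E.is_monoD[OF m, of B s "ZeroHom D B Y"] Comp_Zero_right[OF f S_Obj[OF B]]
          E_arr S_filt[OF B] Y s arr_Zero S_Obj[OF B] filt_Obj[OF Y] by simp
      then show False using zero_object_if_monic_zero[OF t S_filt[OF B] extend(2)] S_nonzero[OF B] by blast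
    qed
    then have "is_iso D B A (f \<cdot> s)" using S_schur[OF B A arr_Comp[OF s f]] by blast
    then obtain g where g: "arr A B g" "f \<cdot> s \<cdot> g = Ident D A" using is_isoE S_Obj A B by metis
    then have "f \<cdot> (s \<cdot> g) = Ident D A" using arr_assoc[OF g(1) s f] by simp
    then have "is_iso E Y A f"
      using E.is_mono_split_epi_is_iso[OF m, of "s \<cdot> g"] E_arr Y S_filt[OF A] f arr_Comp[OF g(1) s] by simp
    then show ?thesis by blast
  qed
qed

lemma brick_if_simple:
  assumes X: "simple_object E X" shows "X \<in> S"
proof -
  have XW: "X \<in> filt S" using X by (simp add: simple_object_def)
  then show ?thesis
  proof cases
    case zero
    then show ?thesis using X XW zero_object_E unfolding simple_object_def by blast
  next
    case (extend B X' s \<pi> \<sigma>)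
    have "is_mono E B X s" using tri_is_mono[OF extend(3) S_filt[OF extend(1)] XW extend(2)] .
    then have "is_iso D B X s"
      using X S_filt[OF extend(1)] S_nonzero[OF extend(1)] zero_object_E unfolding simple_object_def by auto
    then show ?thesis using S_iso[OF extend(1)] filt_Obj[OF XW] by blast
  qed
qed

lemma simple_objects_filt: "Collect (simple_object E) = S"
  using simple_object_brick brick_if_simple by blast

lemma cofilt_finite_length:
  assumes "X \<in> cofilt S" shows "X \<in> filt S \<and> finite_length_object E X"
  using assms
proof (induction rule: cofilt.induct)
  case (zero N)
  then have N: "N \<in> filt S" "zero_object E N" using filt.zero zero_object_E by blast+
  then have "finite_length_object E N"
    unfolding finite_length_object_def by (intro exI[of _ 0] exI[of _ "\<lambda>_. N"]) simp
  then show ?case using N by blast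
next
  case (extend X' A X \<iota> \<pi> \<sigma>)
  then have X: "X \<in> filt S" using W_extension S_filt by blast
  obtain n F where F: "\<forall>k\<le>n. F k \<in> Obj E" "zero_object E (F 0)" "F n = X'"
    "\<forall>k<n. \<exists>S f g. simple_object E S \<and> short_exact E (F k) (F (Suc k)) S f g"
    using extend.IH unfolding finite_length_object_def by blast
  have "\<exists>S f g. simple_object E S \<and> short_exact E X' X S f g"
    using simple_object_brick[OF extend(2)] tri_short_exact[OF extend(3)] extend.IH S_filt[OF extend(2)] by blast
  then have "finite_length_object E X"
    unfolding finite_length_object_def
    using F X by (intro exI[of _ "Suc n"] exI[of _ "F(Suc n := X)"]) (auto simp: less_Suc_eq)
  then show ?case using X by blast
qed

lemma finite_length_E: "finite_length_category E"
  using cofilt_finite_length filt_subset_cofilt S_iso unfolding finite_length_category_def by simp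

end


section \<open>Extensions and t-structures\<close>

context triangulated_category
begin

text \<open>
  Membership in a shifted half is turned into a condition on the shifted object.
\<close>

lemma shifted_iff:
  assumes "A \<subseteq> Obj D" "X \<in> Obj D" shows "X \<in> shifted D A n \<longleftrightarrow> shO n X \<in> A"
proof
  assume "X \<in> shifted D A n"
  then obtain Y where "Y \<in> A" "X = shO (-n) Y" by (auto simp: shifted_def)
  then show "shO n X \<in> A" using shift_Obj_inverse assms by auto
next
  assume "shO n X \<in> A"
  moreover have "X = shO (-n) (shO n X)" using shift_Obj_inverse assms by simp
  ultimately show "X \<in> shifted D A n" unfolding shifted_def by blast
qed

text \<open>
  For an object left orthogonal to the positive part, the second map of its truncation triangle
  \<open>A \<rightarrow> X \<rightarrow> B\<close> vanishes, so the identity of \<open>B\<close> factors through \<open>A[1]\<close>. As \<open>A[1]\<close> is again in the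
  left half, this identity is zero and \<open>X\<close> is isomorphic to \<open>A\<close>.
\<close>

lemma t_structure_left_iff:
  assumes t: "t_structure D L G" and X: "X \<in> Obj D"
  shows "X \<in> L \<longleftrightarrow> (\<forall>Y\<in>shifted D G 1. orth X Y)"
proof
  assume "X \<in> L" then show "\<forall>Y\<in>shifted D G 1. orth X Y" using t unfolding t_structure_def by blast
next
  assume o: "\<forall>Y\<in>shifted D G 1. orth X Y"
  have L: "L \<subseteq> Obj D" using t by (simp add: t_structure_def strict_subcategory_def)
  obtain A B f g h where AB: "A \<in> L" "B \<in> shifted D G 1" and tri: "tri A X B f g h"
    using t X unfolding t_structure_def by blast
  note oo = tri_Obj[OF tri]
  have "Ident D B \<cdot> g = ZeroHom D X B"
    using o AB orthD tri_arr(2)[OF tri] arr_Ident_left by metis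
  then obtain v where v: "arr (shO 1 A) B v" "v \<cdot> h = Ident D B"
    using tri_extend[OF rotate[OF tri] arr_Ident[OF oo(3)]] by blast
  have "A \<in> shifted D L 1" using t AB unfolding t_structure_def by blast
  then have "shO 1 A \<in> L" using shifted_iff[OF L oo(1)] by blast
  then have "orth (shO 1 A) B" using t AB unfolding t_structure_def by blast
  then have "Ident D B = ZeroHom D B B"
    using orthD v Comp_Zero_left[OF tri_arr(3)[OF tri] oo(3)] by metis
  then have "is_iso D A X f" using tri_is_iso_first[OF tri zero_objectI] oo by blast
  then show "X \<in> L" using t AB X unfolding t_structure_def strict_subcategory_def isomorphic_def by blast
qed

lemma t_structure_right_iff:
  assumes t: "t_structure D L G" and X: "X \<in> Obj D"
  shows "X \<in> shifted D G 1 \<longleftrightarrow> (\<forall>Y\<in>L. orth Y X)"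
proof
  assume "X \<in> shifted D G 1" then show "\<forall>Y\<in>L. orth Y X" using t unfolding t_structure_def by blast
next
  assume o: "\<forall>Y\<in>L. orth Y X"
  have G: "G \<subseteq> Obj D" using t by (simp add: t_structure_def strict_subcategory_def)
  obtain A B f g h where AB: "A \<in> L" "B \<in> shifted D G 1" and tri: "tri A X B f g h"
    using t X unfolding t_structure_def by blast
  note oo = tri_Obj[OF tri]
  note r = rotate_back[OF tri]
  have "f \<cdot> Ident D A = ZeroHom D A X"
    using o AB orthD tri_arr(1)[OF tri] arr_Ident_right by metis
  then obtain v where v: "arr A (shO (-1) B) v"
    "neg_hom D (shO (-1) B) A (shH (-1) h) \<cdot> v = Ident D A"
    using tri_lift[OF r arr_Ident[OF oo(1)]] by blast
  have "B \<in> G" using t AB unfolding t_structure_def by blast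
  then have "shO (-1) B \<in> shifted D G 1" by (simp add: shifted_def)
  then have "orth A (shO (-1) B)" using t AB unfolding t_structure_def by blast
  then have "Ident D A = ZeroHom D A A"
    using orthD v Comp_Zero_right[OF tri_arr(1)[OF r] oo(1)] by metis
  then have "is_iso D X B g" using tri_is_iso_second[OF tri zero_objectI] oo by blast
  then obtain g' where "is_iso D B X g'" using is_isoE oo by metis
  then have "is_iso D (shO 1 B) (shO 1 X) (shH 1 g')" using shift_is_iso oo by blast
  moreover have "shO 1 B \<in> G" using shifted_iff[OF G oo(3)] AB by blast
  ultimately have "shO 1 X \<in> G"
    using t ShiftObj_in[OF X] unfolding t_structure_def strict_subcategory_def isomorphic_def by blast
  then show "X \<in> shifted D G 1" using shifted_iff[OF G X] by blast
qed

text \<open>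
  Both conditions are stated with the shift on the other argument, so that they are visibly
  inherited by extensions.
\<close>

lemma t_interval_iff:
  assumes t: "t_structure D L G" and X: "X \<in> Obj D"
  shows "X \<in> t_interval D L G m n \<longleftrightarrow>
    (\<forall>Y\<in>shifted D G 1. orth X (shO (-n) Y)) \<and> (\<forall>Y\<in>L. orth (shO (1 - m) Y) X)"
proof -
  have L: "L \<subseteq> Obj D" and G: "G \<subseteq> Obj D" using t by (simp_all add: t_structure_def strict_subcategory_def)
  have GO: "Y \<in> Obj D" if "Y \<in> shifted D G 1" for Y using that G ShiftObj_in by (auto simp: shifted_def)
  have "X \<in> shifted D L n \<longleftrightarrow> (\<forall>Y\<in>shifted D G 1. orth (shO n X) Y)"
    using shifted_iff[OF L X] t_structure_left_iff[OF t ShiftObj_in[OF X]] by simp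
  moreover have "orth (shO n X) Y \<longleftrightarrow> orth X (shO (-n) Y)" if "Y \<in> shifted D G 1" for Y
    using orth_shift_right_iff[OF X GO[OF that], of "-n"] by simp
  moreover have "X \<in> shifted D G m \<longleftrightarrow> shO (m - 1) X \<in> shifted D G 1"
    using shifted_iff[OF G X] shifted_iff[OF G ShiftObj_in[OF X], of "m - 1" 1] ShiftObj_add[OF X, of 1 "m - 1"] by simp
  moreover have "shO (m - 1) X \<in> shifted D G 1 \<longleftrightarrow> (\<forall>Y\<in>L. orth Y (shO (m - 1) X))"
    using t_structure_right_iff[OF t ShiftObj_in[OF X]] .
  moreover have "orth Y (shO (m - 1) X) \<longleftrightarrow> orth (shO (1 - m) Y) X" if "Y \<in> L" for Y
    using orth_shift_right_iff[of Y X "m - 1"] X L that by auto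
  ultimately show ?thesis unfolding t_interval_def by blast
qed

lemma t_interval_Obj:
  assumes "t_structure D L G" shows "t_interval D L G m n \<subseteq> Obj D"
  using assms ShiftObj_in by (auto simp: t_interval_def shifted_def t_structure_def strict_subcategory_def)

lemma filt_t_interval:
  assumes t: "t_structure D L G" and S: "S \<subseteq> t_interval D L G m n"
  shows "filt S \<subseteq> t_interval D L G m n"
proof
  fix X assume X: "X \<in> filt S"
  have L: "L \<subseteq> Obj D" and G: "G \<subseteq> Obj D" using t by (simp_all add: t_structure_def strict_subcategory_def)
  have A: "(\<forall>Y\<in>shifted D G 1. orth A (shO (-n) Y)) \<and> (\<forall>Y\<in>L. orth (shO (1 - m) Y) A)"
    if "A \<in> S" for A
  proof -
    have "A \<in> t_interval D L G m n" using S that by blast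
    moreover from this have "A \<in> Obj D" using t_interval_Obj[OF t] by blast
    ultimately show ?thesis using t_interval_iff[OF t] by blast
  qed
  have "orth X (shO (-n) Y)" if "Y \<in> shifted D G 1" for Y
  proof (rule filt_orth_left[OF X])
    show "shO (-n) Y \<in> Obj D" using that G ShiftObj_in by (auto simp: shifted_def)
  qed (use A that in blast)
  moreover have "orth (shO (1 - m) Y) X" if "Y \<in> L" for Y
  proof (rule filt_orth_right[OF X])
    show "shO (1 - m) Y \<in> Obj D" using that L ShiftObj_in by auto
  qed (use A that in blast)
  ultimately show "X \<in> t_interval D L G m n"
    unfolding t_interval_iff[OF t filt_Obj[OF X]] by blast
qed

end


section \<open>Semibricks and simple objects\<close>

context triangulated_category
begin

text \<open>
  A nonzero morphism between members forces them to be isomorphic; after composing with an isomorphism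
  it becomes a nonzero endomorphism of a brick.
\<close>

lemma semibrick_orthogonal_bricks:
  assumes t: "t_structure D L G" and S: "semibrick D L G d S"
  shows "orthogonal_bricks D S"
proof
  have SO: "S \<subseteq> Obj D" using S t_interval_Obj[OF t] by (auto simp: semibrick_def)
  then show "S \<subseteq> Obj D" .
  show "no_negative_homs D S" using S by (simp add: semibrick_def)
  show "Y \<in> S" if "X \<in> S" "is_iso D X Y i" "Y \<in> Obj D" for X Y i
    using that S unfolding semibrick_def isomorphic_def by blast
  have brick: "\<not> zero_object D X" "arr X X f \<Longrightarrow> f \<noteq> ZeroHom D X X \<Longrightarrow> is_iso D X X f"
    if "X \<in> S" for X f
    using that S SO division_ring_end_ring_iff[of X] unfolding semibrick_def by blast+
  show "\<not> zero_object D X" if "X \<in> S" for X using brick that by blast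
  fix X Y f assume X: "X \<in> S" and Y: "Y \<in> S" and f: "arr X Y f" "f \<noteq> ZeroHom D X Y"
  note o = arrD(1,2)[OF f(1)]
  have "isomorphic D X Y" using S X Y f orthD[OF _ f(1)] unfolding semibrick_def by blast
  then obtain i where "is_iso D X Y i" unfolding isomorphic_def by blast
  then obtain j where ij: "is_iso D X Y i" "arr X Y i" "arr Y X j" "i \<cdot> j = Ident D Y"
    using is_isoE o by metis
  have f_eq: "f = i \<cdot> (j \<cdot> f)" using arr_assoc[OF f(1) ij(3,2)] ij(4) arr_Ident_left[OF f(1)] by simp
  have "j \<cdot> f \<noteq> ZeroHom D X X" using f_eq f(2) Comp_Zero_right[OF ij(2) o(1)] by metis
  then have "is_iso D X X (j \<cdot> f)" using brick(2)[OF X arr_Comp[OF f(1) ij(3)]] by blast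
  then show "is_iso D X Y f" using is_iso_Comp[OF _ ij(1) o(1,1,2)] f_eq by metis
qed

lemma filt_finite_length_wide:
  assumes t: "t_structure D L G" and S: "semibrick D L G d S"
  shows "finite_length_wide_subcategory D L G d (filt S)"
proof -
  interpret orthogonal_bricks D S using semibrick_orthogonal_bricks[OF assms] .
  have adm: "admissible X Y f" if "X \<in> filt S" "Y \<in> filt S" "f \<in> Hom D X Y" for X Y f
    using filt_admissible that arrI filt_Obj by blast
  have "filt S \<subseteq> t_interval D L G (- int d + 1) 0"
    using filt_t_interval[OF t] S by (simp add: semibrick_def)
  then show ?thesis
    unfolding finite_length_wide_subcategory_def wide_subcategory_def
    using strict closed no_neg abelian_E[OF adm] short_exact_iff_tri[OF adm] finite_length_E by blast
qed

text \<open>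
  Schur's lemma gives both that endomorphism rings are division rings and that non-isomorphic simple
  objects are orthogonal.
\<close>

lemma simple_objects_semibrick:
  assumes W: "wide_subcategory D L G d W"
  shows "semibrick D L G d (Collect (simple_object (full_subcategory D W)))" (is "semibrick D L G d ?S")
  unfolding semibrick_def
proof (intro conjI ballI impI)
  have WO: "W \<subseteq> Obj D" using W by (simp add: wide_subcategory_def strict_subcategory_def)
  interpret E: abelian_category "full_subcategory D W" using W by (simp add: wide_subcategory_def)
  have SW: "?S \<subseteq> W" by (auto simp: simple_object_def)
  show "?S \<subseteq> t_interval D L G (- int d + 1) 0" using SW W unfolding wide_subcategory_def by blast
  show "no_negative_homs D ?S"
    using SW W unfolding wide_subcategory_def no_negative_homs_def by blast
  have schur: "is_iso D X Y f" if "X \<in> ?S" "Y \<in> ?S" "arr X Y f" "f \<noteq> ZeroHom D X Y" for X Y f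
    using E.schur[of X Y f] that SW by (auto simp: E.arr_def arr_def)
  fix X assume X: "X \<in> ?S"
  then have XW: "X \<in> W" and XO: "X \<in> Obj D" using SW WO by blast+
  show "division_ring (end_ring D X)"
  proof -
    have "\<not> zero_object D X"
      using X XW zero_object_full_subcategory[OF WO] by (simp add: simple_object_def)
    then show ?thesis using division_ring_end_ring_iff[OF XO] schur[OF X X] by blast
  qed
  { fix Y assume Y: "Y \<in> Obj D" and i: "isomorphic D X Y"
    then have YW: "Y \<in> W" using W XW unfolding wide_subcategory_def strict_subcategory_def by blast
    obtain j where "is_iso D Y X j" using isomorphic_sym[OF i XO Y] by (auto simp: isomorphic_def)
    then show "Y \<in> ?S" using E.simple_object_isomorphic[of X Y j] X YW by simp }
  { fix Y assume Y: "Y \<in> ?S" and i: "\<not> isomorphic D X Y"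
    show "orth X Y"
      using orthI[OF XO] schur[OF X Y] i Y SW WO unfolding isomorphic_def by blast }
qed

text \<open>
  Each step of a composition series is a short exact sequence, which wideness turns into a triangle.
\<close>

lemma filt_simple_objects:
  assumes W: "finite_length_wide_subcategory D L G d W"
  shows "filt (Collect (simple_object (full_subcategory D W))) = W" (is "filt ?S = W")
proof
  let ?E = "full_subcategory D W"
  have w: "wide_subcategory D L G d W" using W by (simp add: finite_length_wide_subcategory_def)
  then have WO: "W \<subseteq> Obj D" by (simp add: wide_subcategory_def strict_subcategory_def)
  interpret E: abelian_category ?E using w by (simp add: wide_subcategory_def)
  have SW: "?S \<subseteq> W" by (auto simp: simple_object_def)
  show "filt ?S \<subseteq> W" using filt_subset SW w unfolding wide_subcategory_def by blast
  show "W \<subseteq> filt ?S"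
  proof
    fix X assume "X \<in> W"
    then have "finite_length_object ?E X"
      using W by (simp add: finite_length_wide_subcategory_def finite_length_category_def)
    then obtain n F where F: "\<forall>k\<le>n. F k \<in> W" "zero_object ?E (F 0)" "F n = X"
      "\<forall>k<n. \<exists>S f g. simple_object ?E S \<and> short_exact ?E (F k) (F (Suc k)) S f g"
      unfolding finite_length_object_def by auto
    have "F k \<in> filt ?S" if "k \<le> n" for k
      using that
    proof (induction k)
      case 0
      then show ?case using F(2) zero_object_full_subcategory[OF WO] filt.zero by blast
    next
      case (Suc k)
      then obtain A f g where A: "simple_object ?E A" and s: "short_exact ?E (F k) (F (Suc k)) A f g"
        using F(4) by (meson Suc_le_lessD)
      have "F k \<in> W" "F (Suc k) \<in> W" "A \<in> W" using F(1) Suc.prems SW A by auto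
      moreover have "f \<in> Hom D (F k) (F (Suc k))" "g \<in> Hom D (F (Suc k)) A"
        using s by (simp_all add: short_exact_def is_kernel_def is_cokernel_def)
      ultimately obtain h where tri: "tri (F k) (F (Suc k)) A f g h"
        using w s unfolding wide_subcategory_def by blast
      have "A \<in> filt ?S" using filt_generator A SW WO by blast
      then show ?case using filt_extension[OF _ tri] Suc by simp
    qed
    then show "X \<in> filt ?S" using F(3) by blast
  qed
qed

end

theorem proposition4p5:
  fixes D :: "('o, 'm, 'x) triangulated_category_scheme" and L G :: "'o set" and d :: nat
  assumes "triangulated_category D"
    and "bounded_t_structure D L G"
    and "d \<ge> 1"
  shows "\<exists>\<Phi>. bij_betw \<Phi> {\<S>. semibrick D L G d \<S>} {W. finite_length_wide_subcategory D L G d W}"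
proof -
  interpret triangulated_category D by fact
  have t: "t_structure D L G" using assms(2) by (simp add: bounded_t_structure_def)
  let ?simples = "\<lambda>W. Collect (simple_object (full_subcategory D W))"
  have "bij_betw filt {\<S>. semibrick D L G d \<S>} {W. finite_length_wide_subcategory D L G d W}"
  proof (rule bij_betwI[where g = ?simples])
    show "filt \<in> {\<S>. semibrick D L G d \<S>} \<rightarrow> {W. finite_length_wide_subcategory D L G d W}"
      using filt_finite_length_wide[OF t] by blast
    show "?simples \<in> {W. finite_length_wide_subcategory D L G d W} \<rightarrow> {\<S>. semibrick D L G d \<S>}"
      using simple_objects_semibrick by (auto simp: finite_length_wide_subcategory_def)
    show "?simples (filt S) = S" if "S \<in> {\<S>. semibrick D L G d \<S>}" for S
      using orthogonal_bricks.simple_objects_filt semibrick_orthogonal_bricks[OF t] that by blast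
    show "filt (?simples W) = W" if "W \<in> {W. finite_length_wide_subcategory D L G d W}" for W
      using filt_simple_objects that by blast
  qed
  then show ?thesis by blast
qed

end
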